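(* Let $\mu$ be a strongly Rayleigh distribution on $[m]$, let $A_1,\ldots,A_n$ be random variables counting the number of elements (of the random set sampled from $\mu$) contained in some associated disjoint subsets of $[m]$, and fix $\kappa \in \mathbb{Z}_{\geq 0}^n$. Suppose for all $S \subseteq [n]$ we have $|\mathbb{E}_\mu[A_S] - \kappa_S| < 1$. Define $\epsilon,\delta \in \mathbb{R}_{> 0}^n$ via $$\delta_k := 1 + \min_{S \in \binom{[n]}{k}} \left(\mathbb{E}_\mu[A_S] - \kappa_S\right) \qquad \text{and} \qquad \epsilon_k := 1 - \max_{S \in \binom{[n]}{k}} \left(\mathbb{E}_\mu[A_S] - \kappa_S\right)$$ for $k\in[n]$. Then $$\mathbb{P}_\mu[A_1 = \kappa_1, \ldots, A_n = \kappa_n] \geq \left(\prod_{i=1}^n \frac{\kappa_i^{\kappa_i} e^{-\kappa_i}}{\kappa_i!}\right) \cdot \min_{0 \leq \ell \leq n} \left(\prod_{k=1}^\ell \epsilon_k \prod_{k=1}^{n-\ell} \delta_k\right).$$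
   Context: $A_S := \sum_{i\in S}A_i$, $\kappa_S := \sum_{i\in S}\kappa_i$, $[n]=\{1,\dots,n\}$, $\binom{[n]}{k}$ is the set of $k$-element subsets of $[n]$, and $0^0=1$. A probability distribution $\mu$ on subsets of $[m]$ is strongly Rayleigh if its generating polynomial $g_\mu(z) = \sum_{S\subseteq[m]} \mu(S)\prod_{e\in S} z_e$ is real stable, i.e. $g_\mu(z)\ne 0$ whenever $\operatorname{Im}(z_e)>0$ for all $e$. If $T\sim\mu$ and $D_1,\dots,D_n\subseteq[m]$ are the given pairwise disjoint subsets, then $A_i=|T\cap D_i|$. *)

theory Defs
  imports "HOL-Probability.Probability"
begin

(* A distribution on subsets of [m] is a pmf on nat set supported on Pow {1..m}. *)
definition gen_poly :: "nat \<Rightarrow> nat set pmf \<Rightarrow> (nat \<Rightarrow> complex) \<Rightarrow> complex" where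
  "gen_poly m \<mu> z = (\<Sum>S\<in>Pow {1..m}. of_real (pmf \<mu> S) * (\<Prod>e\<in>S. z e))"

definition strongly_Rayleigh :: "nat \<Rightarrow> nat set pmf \<Rightarrow> bool" where
  "strongly_Rayleigh m \<mu> \<longleftrightarrow>
     set_pmf \<mu> \<subseteq> Pow {1..m} \<and>
     (\<forall>z. (\<forall>e\<in>{1..m}. Im (z e) > 0) \<longrightarrow> gen_poly m \<mu> z \<noteq> 0)"

definition count_in :: "(nat \<Rightarrow> nat set) \<Rightarrow> nat \<Rightarrow> nat set \<Rightarrow> nat" where
  "count_in D i T = card (T \<inter> D i)"

(* E[A_S] - kappa_S *)
definition deviation ::
  "nat set pmf \<Rightarrow> (nat \<Rightarrow> nat set) \<Rightarrow> (nat \<Rightarrow> nat) \<Rightarrow> nat set \<Rightarrow> real" where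
  "deviation \<mu> D \<kappa> S =
     measure_pmf.expectation \<mu> (\<lambda>T. \<Sum>i\<in>S. real (count_in D i T)) - (\<Sum>i\<in>S. real (\<kappa> i))"

(* The minimum and maximum are taken over a nonempty set only for k \<le> n;
   both functions are meant for k in {1..n}. *)
definition delta ::
  "nat \<Rightarrow> nat set pmf \<Rightarrow> (nat \<Rightarrow> nat set) \<Rightarrow> (nat \<Rightarrow> nat) \<Rightarrow> nat \<Rightarrow> real" where
  "delta n \<mu> D \<kappa> k = 1 + (MIN S\<in>{S. S \<subseteq> {1..n} \<and> card S = k}. deviation \<mu> D \<kappa> S)"

definition epsilon ::
  "nat \<Rightarrow> nat set pmf \<Rightarrow> (nat \<Rightarrow> nat set) \<Rightarrow> (nat \<Rightarrow> nat) \<Rightarrow> nat \<Rightarrow> real" where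
  "epsilon n \<mu> D \<kappa> k = 1 - (MAX S\<in>{S. S \<subseteq> {1..n} \<and> card S = k}. deviation \<mu> D \<kappa> S)"

end

theory Submission
  imports Defs "HOL-Complex_Analysis.Complex_Analysis" "HOL-Computational_Algebra.Fundamental_Theorem_Algebra"
begin

text \<open>
  Let \<open>g(y)\<close> be the generating polynomial of the distribution, and let \<open>p(x)\<close> be \<open>g\<close> with
  \<open>y\<^sub>e = x\<^sub>i\<close> for \<open>e \<in> D\<^sub>i\<close> and \<open>y\<^sub>e = 1\<close> outside all the \<open>D\<^sub>i\<close>, so that the wanted probability is the
  coefficient of \<open>x\<^sup>\<kappa>\<close> in \<open>p\<close>. The bound is a product because it arises in two independent steps that
  meet at the capacity, the infimum of \<open>p(x) / x\<^sup>\<kappa>\<close> over positive \<open>x\<close>.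

  The coefficient is at least the capacity times the Poisson-like product
  (lemma \<open>coefficient_ge_capacity\<close>). Along a positive direction a stable polynomial is real-rooted, hence
  log-concave where it is positive, so the tangent to \<open>ln h\<close> at \<open>s\<close> bounds \<open>h(t)\<close> from above. If
  \<open>h(t) \<ge> C t\<^sup>k\<close> for all \<open>t > 0\<close>, the best choice of \<open>t\<close> turns this into a lower bound for \<open>h'(s)\<close> of the form
  \<open>C' s\<^sup>k\<^sup>-\<^sup>1\<close>, with \<open>C'/C\<close> the ratio of consecutive values of \<open>k\<^sup>k e\<^sup>-\<^sup>k\<close>. Taking \<open>\<kappa>\<^sub>i\<close> derivatives in each
  \<open>x\<^sub>i\<close> and letting \<open>x\<close> tend to \<open>0\<close> yields the coefficient. A partial derivative may
  vanish identically on a line parallel to a coordinate axis, and stability would be lost there; the operator \<open>\<epsilon> + \<partial>\<^sub>i\<close> never does, by the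
  Gauss--Lucas argument, and it only improves the lower bound. So \<open>\<epsilon>\<close> is kept positive until
  the very end, where only an inequality between values has to pass to the limit.

  The capacity is at least the minimum over \<open>l\<close> (lemmas \<open>capacity_bound\<close> and \<open>truncated_products_ge_Min\<close>). Given
  \<open>x\<close>, raise the smallest of its values, taken on a set \<open>S\<close> of \<open>k\<close> blocks, to the next larger value, and go on
  until no value is below \<open>1\<close>. Raising \<open>S\<close> from \<open>c\<close> to \<open>c'\<close> changes \<open>p\<close> by a factor that is compared with
  the expectation of \<open>r\<close> to the power \<open>A\<^sub>S\<close>, where \<open>r = c/c'\<close>: negative dependence makes the probability of an
  element of \<open>S\<close> smaller under the field \<open>x\<close> than without a field (lemmas \<open>incl_prob_le\<close> and \<open>weight_poly_peel\<close>).
  As \<open>A\<^sub>S\<close> is an integer, the convex function \<open>N \<mapsto> r\<^sup>N\<close> lies above its chord through two consecutive integers, so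
  this expectation is at least \<open>r\<close> to the power \<open>\<kappa>\<^sub>S\<close> times \<open>min 1 \<epsilon>\<^sub>k\<close>. The values above \<open>1\<close> are lowered in
  the same way and give the factors \<open>min 1 \<delta>\<^sub>k\<close>. The powers of \<open>r\<close> multiply to \<open>x\<^sup>\<kappa>\<close>.

  It remains to replace \<open>min 1 \<epsilon>\<^sub>k\<close> and \<open>min 1 \<delta>\<^sub>k\<close> by \<open>\<epsilon>\<^sub>k\<close> and \<open>\<delta>\<^sub>k\<close>. The deviation is additive in \<open>S\<close>, so if it is
  negative on all sets of size \<open>k\<close>, it is negative on all larger sets and on some set of every smaller
  positive size. Hence once some \<open>\<epsilon>\<^sub>k\<close> exceeds \<open>1\<close>, all later ones do and every \<open>\<delta>\<^sub>k\<close> is below \<open>1\<close>, and cutting the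
  product of the \<open>\<epsilon>\<^sub>k\<close> just before \<open>k\<close> in favour of more factors \<open>\<delta>\<^sub>k\<close> gives a member of the minimum that is no
  larger than the truncated product.
\<close>

section \<open>Self-maps of a half-plane\<close>

text \<open>The Schwarz lemma transported by Cayley transforms on both sides, in its two-point form. At real points
  with real values the pseudo-hyperbolic distance has no complex conjugates.\<close>
lemma schwarz_pick_right_half_plane:
  fixes G :: "complex \<Rightarrow> complex" and u v p q :: real
  assumes hol: "G holomorphic_on {w. Re w > 0}"
    and pos: "\<And>w. Re w > 0 \<Longrightarrow> Re (G w) > 0"
    and uv: "u > 0" "v > 0" and pq: "G (of_real u) = of_real p" "G (of_real v) = of_real q"
  shows "\<bar>q - p\<bar> * (v + u) \<le> \<bar>v - u\<bar> * (q + p)"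
proof -
  define c where "c = (\<lambda>\<zeta>. of_real u * (1 + \<zeta>) / (1 - \<zeta>) :: complex)"
  define h where "h = (\<lambda>\<zeta>. (G (c \<zeta>) - of_real p) / (G (c \<zeta>) + of_real p))"
  have p0: "p > 0" and q0: "q > 0"
    using pos[of "of_real u"] pos[of "of_real v"] uv pq by auto
  have c_pos: "Re (c \<zeta>) > 0" if "norm \<zeta> < 1" for \<zeta>
  proof -
    have "1 - \<zeta> \<noteq> 0" using that by auto
    have "Re (c \<zeta>) = u * (1 - (norm \<zeta>)\<^sup>2) / (norm (1 - \<zeta>))\<^sup>2"
      unfolding c_def Re_divide cmod_power2 by (simp add: field_simps power2_eq_square)
    moreover have "(norm \<zeta>)\<^sup>2 < 1" using that by (simp add: abs_square_less_1)
    ultimately show ?thesis using uv \<open>1 - \<zeta> \<noteq> 0\<close> by simp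
  qed
  have den: "G (c \<zeta>) + of_real p \<noteq> 0" if "norm \<zeta> < 1" for \<zeta>
  proof
    assume "G (c \<zeta>) + of_real p = 0"
    then have "Re (G (c \<zeta>) + of_real p) = 0" by simp
    then show False using pos[OF c_pos[OF that]] p0 by simp
  qed
  have c_hol: "c holomorphic_on ball 0 1"
    unfolding c_def by (intro holomorphic_intros) (auto simp: dist_norm)
  have "(G \<circ> c) holomorphic_on ball 0 1"
    by (rule holomorphic_on_compose_gen[OF c_hol hol]) (use c_pos in auto)
  then have h_hol: "h holomorphic_on ball 0 1"
    unfolding h_def o_def by (intro holomorphic_intros) (use den in auto)
  have h0: "h 0 = 0" by (simp add: h_def c_def pq)
  have h_lt: "norm (h \<zeta>) < 1" if "norm \<zeta> < 1" for \<zeta>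
  proof -
    have g: "Re (G (c \<zeta>)) > 0" using pos[OF c_pos[OF that]] .
    have "(norm (G (c \<zeta>) - of_real p))\<^sup>2 < (norm (G (c \<zeta>) + of_real p))\<^sup>2"
      using g p0 unfolding cmod_power2 by (simp add: power2_eq_square algebra_simps)
    then have "norm (G (c \<zeta>) - of_real p) < norm (G (c \<zeta>) + of_real p)"
      by (rule power2_less_imp_less) simp
    then show ?thesis using den[OF that] by (simp add: h_def norm_divide)
  qed
  \<comment> \<open>the point of the disc that the Cayley transform \<open>c\<close> sends to \<open>v\<close>\<close>
  define t where "t = (v - u) / (v + u)"
  have t1: "\<bar>t\<bar> < 1" using uv by (simp add: t_def abs_if field_simps)
  have "1 + t = 2 * v / (v + u)" "1 - t = 2 * u / (v + u)"
    using uv by (simp_all add: t_def field_simps)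
  then have tt: "u * (1 + t) / (1 - t) = v" using uv by simp
  have "c (of_real t) = of_real (u * (1 + t) / (1 - t))"
    unfolding c_def by simp
  then have ct: "c (of_real t) = of_real v" using tt by simp
  have "norm (h (of_real t)) \<le> norm (of_real t :: complex)"
    by (rule Schwarz_Lemma(1)[OF h_hol h0 h_lt]) (use t1 in simp)+
  moreover have "h (of_real t) = of_real ((q - p) / (q + p))"
    unfolding h_def ct pq by simp
  ultimately have "\<bar>(q - p) / (q + p)\<bar> \<le> \<bar>t\<bar>" by (metis norm_of_real)
  then show ?thesis using uv p0 q0 by (simp add: t_def abs_divide field_simps)
qed

text \<open>Substituting \<open>s = w\<^sup>2\<close> and taking a square root turns \<open>K\<close> into a self-map \<open>G\<close> of the right half-plane. On
  positive reals the Schwarz--Pick inequality says exactly that \<open>w G(w)\<close> increases, and its square is \<open>s K(s)\<close>.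
  Positivity on the positive axis keeps the values of \<open>K\<close> in the slit plane, where the square root is holomorphic.\<close>
lemma slit_plane_monotone:
  fixes K :: "complex \<Rightarrow> complex" and k :: "real \<Rightarrow> real"
  assumes hol: "K holomorphic_on - \<real>\<^sub>\<le>\<^sub>0"
    and up: "\<And>s. Im s > 0 \<Longrightarrow> Im (K s) < 0" and lo: "\<And>s. Im s < 0 \<Longrightarrow> Im (K s) > 0"
    and re: "\<And>x. x > 0 \<Longrightarrow> K (of_real x) = of_real (k x)" and kpos: "\<And>x. x > 0 \<Longrightarrow> k x > 0"
    and xy: "0 < x" "x \<le> y"
  shows "x * k x \<le> y * k y"
proof -
  define G where "G = (\<lambda>w. csqrt (K (w\<^sup>2)))"
  have sq: "w\<^sup>2 \<in> - \<real>\<^sub>\<le>\<^sub>0" if "Re w > 0" for w :: complex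
  proof
    assume "w\<^sup>2 \<in> \<real>\<^sub>\<le>\<^sub>0"
    then have "Im (w\<^sup>2) = 0" "Re (w\<^sup>2) \<le> 0" by (auto simp: complex_nonpos_Reals_iff)
    then have "Im w = 0" using that by (simp add: power2_eq_square)
    then have "Re (w\<^sup>2) = Re w * Re w" by (simp add: power2_eq_square)
    then show False using \<open>Re (w\<^sup>2) \<le> 0\<close> mult_pos_pos[OF that that] by linarith
  qed
  have Kslit: "K s \<in> - \<real>\<^sub>\<le>\<^sub>0" if "s \<in> - \<real>\<^sub>\<le>\<^sub>0" for s
  proof (cases "Im s = 0")
    case True
    then have "Re s > 0" "s = of_real (Re s)" using that
      by (auto simp: complex_nonpos_Reals_iff complex_eq_iff)
    then have "K s = of_real (k (Re s))" "k (Re s) > 0" using re[of "Re s"] kpos by auto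
    then show ?thesis by (simp add: complex_nonpos_Reals_iff)
  next
    case False
    then show ?thesis using up[of s] lo[of s] by (cases "Im s > 0") (auto simp: complex_nonpos_Reals_iff)
  qed
  have "(K \<circ> (\<lambda>w. w\<^sup>2)) holomorphic_on {w. Re w > 0}"
    by (rule holomorphic_on_compose_gen[OF _ hol]) (use sq in \<open>auto intro!: holomorphic_intros\<close>)
  then have "G holomorphic_on {w. Re w > 0}"
    unfolding G_def o_def by (rule holomorphic_on_csqrt') (use Kslit sq in auto)
  moreover have "Re (G w) > 0" if "Re w > 0" for w
  proof -
    have "K (w\<^sup>2) \<notin> \<real>\<^sub>\<le>\<^sub>0" using Kslit[OF sq[OF that]] by simp
    moreover have "K (w\<^sup>2) = (G w)\<^sup>2" by (simp add: G_def)
    ultimately have "Re (G w) \<noteq> 0"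
      by (auto simp: complex_nonpos_Reals_iff power2_eq_square)
    then show ?thesis using Re_csqrt[of "K (w\<^sup>2)"] by (simp add: G_def)
  qed
  moreover have G_real: "G (of_real (sqrt t)) = of_real (sqrt (k t))" if "t > 0" for t
  proof -
    have "(of_real (sqrt t) :: complex)\<^sup>2 = of_real t"
      using that by (simp flip: of_real_power)
    then show ?thesis using that re kpos[OF that] by (simp add: G_def)
  qed
  ultimately have *: "\<bar>sqrt (k y) - sqrt (k x)\<bar> * (sqrt y + sqrt x)
      \<le> \<bar>sqrt y - sqrt x\<bar> * (sqrt (k y) + sqrt (k x))"
    using xy by (intro schwarz_pick_right_half_plane[of G]) auto
  have "sqrt x \<le> sqrt y" using xy by simp
  moreover have "(sqrt (k x) - sqrt (k y)) * (sqrt y + sqrt x)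
      \<le> \<bar>sqrt (k y) - sqrt (k x)\<bar> * (sqrt y + sqrt x)"
    using xy by (intro mult_right_mono) auto
  ultimately have "(sqrt (k x) - sqrt (k y)) * (sqrt y + sqrt x)
      \<le> (sqrt y - sqrt x) * (sqrt (k y) + sqrt (k x))"
    using * by simp
  then have "sqrt x * sqrt (k x) \<le> sqrt y * sqrt (k y)" by (simp add: algebra_simps)
  then show ?thesis by (simp flip: real_sqrt_mult)
qed

section \<open>Multi-affine polynomials without zeros in a half-plane\<close>

definition weight_poly :: "nat set \<Rightarrow> (nat set \<Rightarrow> real) \<Rightarrow> (nat \<Rightarrow> 'a::real_normed_field) \<Rightarrow> 'a" where
  "weight_poly U w z = (\<Sum>T\<in>Pow U. of_real (w T) * (\<Prod>e\<in>T. z e))"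

definition half_plane_stable :: "nat set \<Rightarrow> (nat set \<Rightarrow> real) \<Rightarrow> bool" where
  "half_plane_stable U w \<longleftrightarrow> (\<forall>z. (\<forall>e\<in>U. Im (z e) > 0) \<longrightarrow> weight_poly U w z \<noteq> 0)"

lemma weight_poly_cong: "(\<And>e. e \<in> U \<Longrightarrow> y e = z e) \<Longrightarrow> weight_poly U w y = weight_poly U w z"
  unfolding weight_poly_def by (rule sum.cong[OF refl], subst prod.cong[where h = z, OF refl]) auto

lemma weight_poly_split:
  assumes "finite U" "e \<in> U"
  shows "weight_poly U w z = weight_poly (U - {e}) w z + z e * weight_poly (U - {e}) (\<lambda>T. w (insert e T)) z"
proof -
  let ?V = "U - {e}"
  have U: "U = insert e ?V" using assms by auto
  have "weight_poly U w z = (\<Sum>T\<in>Pow ?V \<union> insert e ` Pow ?V. of_real (w T) * (\<Prod>e\<in>T. z e))"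
    unfolding weight_poly_def by (metis U Pow_insert)
  also have "\<dots> = weight_poly ?V w z + (\<Sum>T\<in>insert e ` Pow ?V. of_real (w T) * (\<Prod>e\<in>T. z e))"
    unfolding weight_poly_def using assms by (intro sum.union_disjoint) auto
  also have "(\<Sum>T\<in>insert e ` Pow ?V. of_real (w T) * (\<Prod>e\<in>T. z e))
      = (\<Sum>T\<in>Pow ?V. of_real (w (insert e T)) * (\<Prod>e\<in>insert e T. z e))"
    by (rule sum.reindex_cong[of "insert e"]) (auto simp: inj_on_def)
  also have "\<dots> = z e * weight_poly ?V (\<lambda>T. w (insert e T)) z"
    unfolding weight_poly_def sum_distrib_left
  proof (rule sum.cong[OF refl])
    fix T assume "T \<in> Pow ?V"
    then have "e \<notin> T" "finite T" using assms finite_subset by auto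
    then show "of_real (w (insert e T)) * (\<Prod>e\<in>insert e T. z e) =
         z e * (of_real (w (insert e T)) * (\<Prod>e\<in>T. z e))" by simp
  qed
  finally show ?thesis .
qed

lemma weight_poly_of_real: "weight_poly U w (\<lambda>e. of_real (y e)) = of_real (weight_poly U w y)"
  by (simp add: weight_poly_def)

lemma weight_poly_cnj: "weight_poly U w (\<lambda>e. cnj (z e)) = cnj (weight_poly U w z)"
  by (simp add: weight_poly_def)

lemma weight_poly_nonneg:
  fixes y :: "nat \<Rightarrow> real"
  assumes "\<And>T. w T \<ge> 0" "\<And>e. e \<in> U \<Longrightarrow> y e \<ge> 0" shows "weight_poly U w y \<ge> 0"
  unfolding weight_poly_def using assms by (auto intro!: sum_nonneg mult_nonneg_nonneg prod_nonneg)

lemma weight_poly_pos: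
  fixes y :: "nat \<Rightarrow> real"
  assumes "finite U" "\<And>T. w T \<ge> 0" "T \<subseteq> U" "w T > 0" "\<And>e. e \<in> U \<Longrightarrow> y e > 0"
  shows "weight_poly U w y > 0"
proof -
  have "0 < of_real (w T) * (\<Prod>e\<in>T. y e)"
    using assms by (auto intro!: mult_pos_pos prod_pos)
  also have "\<dots> \<le> weight_poly U w y" unfolding weight_poly_def
  proof (rule member_le_sum)
    fix T' assume "T' \<in> Pow U - {T}"
    then have "y e \<ge> 0" if "e \<in> T'" for e using assms(5)[of e] that by auto
    then show "0 \<le> of_real (w T') * (\<Prod>e\<in>T'. y e)"
      using assms(2) by (simp add: prod_nonneg)
  qed (use assms in auto)
  finally show ?thesis .
qed

lemma stable_imp_weight:
  assumes "half_plane_stable U w" "finite U" shows "\<exists>T\<subseteq>U. w T \<noteq> 0"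
proof (rule ccontr)
  assume "\<not> ?thesis"
  then have "weight_poly U w (\<lambda>_. \<i>) = 0" unfolding weight_poly_def by (intro sum.neutral) auto
  then show False using assms by (auto simp: half_plane_stable_def)
qed

text \<open>Stated with a conjugate rather than with the quotient \<open>a / b\<close>, so that it passes to limits and
  covers the zeros of \<open>b\<close>.\<close>
lemma affine_nonzero_imp_Im:
  assumes "\<And>z. Im z > 0 \<Longrightarrow> a + z * b \<noteq> (0::complex)"
  shows "Im (a * cnj b) \<ge> 0"
proof (rule ccontr)
  assume neg: "\<not> ?thesis"
  then have b: "b \<noteq> 0" by auto
  have "- (a / b) = - (a * cnj b) / of_real ((norm b)\<^sup>2)"
    using b by (simp add: complex_div_cnj[of a b])
  then have "Im (- (a / b)) > 0"
    using neg b by (simp add: Im_divide_of_real zero_less_divide_iff divide_less_0_iff)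
  from assms[OF this] show False using b by simp
qed

lemma stable_Im:
  assumes "half_plane_stable U w" "finite U" "e \<in> U" "\<And>f. f \<in> U - {e} \<Longrightarrow> Im (z f) > 0"
  shows "Im (weight_poly (U - {e}) w z * cnj (weight_poly (U - {e}) (\<lambda>T. w (insert e T)) z)) \<ge> 0"
proof (rule affine_nonzero_imp_Im)
  fix s :: complex assume s: "Im s > 0"
  have "weight_poly U w (z(e := s)) \<noteq> 0" using assms s by (auto simp: half_plane_stable_def)
  also have "weight_poly U w (z(e := s)) = weight_poly (U - {e}) w z + s * weight_poly (U - {e}) (\<lambda>T. w (insert e T)) z"
    using weight_poly_split[OF assms(2,3), of w "z(e := s)"] weight_poly_cong[of "U - {e}" "z(e := s)" z]
    by simp
  finally show "weight_poly (U - {e}) w z + s * weight_poly (U - {e}) (\<lambda>T. w (insert e T)) z \<noteq> 0" .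
qed

text \<open>Negative correlation of two elements under any positive external field. Evaluating \<open>stable_Im\<close> at
  \<open>y\<^sub>f = \<i>\<close> makes the imaginary part the difference of the two products; the remaining variables approach the
  real point \<open>y\<close> from the upper half-plane.\<close>
lemma rayleigh_inequality:
  fixes y :: "nat \<Rightarrow> real"
  assumes st: "half_plane_stable U w" and fin: "finite U" and ef: "e \<in> U" "f \<in> U" "e \<noteq> f"
  defines "V \<equiv> U - {e} - {f}"
  shows "weight_poly V w y * weight_poly V (\<lambda>T. w (insert e (insert f T))) y
       \<le> weight_poly V (\<lambda>T. w (insert f T)) y * weight_poly V (\<lambda>T. w (insert e T)) y"
proof -
  define z where "z = (\<lambda>\<eta> g. (if g = f then \<i> else of_real (y g) + \<i> * of_real \<eta>))"
  define P where "P = (\<lambda>v \<eta>. weight_poly V v (z \<eta>))"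
  let ?wf = "\<lambda>T. w (insert f T)" and ?we = "\<lambda>T. w (insert e T)" and ?wef = "\<lambda>T. w (insert e (insert f T))"
  have lim: "(P v \<longlongrightarrow> of_real (weight_poly V v y)) (at_right 0)" for v
  proof -
    have "((\<lambda>\<eta>. weight_poly V v (\<lambda>g. of_real (y g) + \<i> * of_real \<eta>)) \<longlongrightarrow> weight_poly V v (\<lambda>g. of_real (y g) + \<i> * of_real 0)) (at_right 0)"
      unfolding weight_poly_def by (intro tendsto_intros)
    moreover have "P v = (\<lambda>\<eta>. weight_poly V v (\<lambda>g. of_real (y g) + \<i> * of_real \<eta>))"
      unfolding P_def by (intro ext weight_poly_cong) (auto simp: z_def V_def)
    ultimately show ?thesis by (simp add: weight_poly_of_real)
  qed
  have fU: "f \<in> U - {e}" using ef by auto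
  have ineq: "Im ((P w \<eta> + \<i> * P ?wf \<eta>) * cnj (P ?we \<eta> + \<i> * P ?wef \<eta>)) \<ge> 0" if "\<eta> > 0" for \<eta>
  proof -
    have "Im (z \<eta> g) > 0" for g using that by (simp add: z_def)
    from stable_Im[OF st fin ef(1) this]
    have "Im (weight_poly (U - {e}) w (z \<eta>) * cnj (weight_poly (U - {e}) ?we (z \<eta>))) \<ge> 0" .
    moreover have "weight_poly (U - {e}) v (z \<eta>) = P v \<eta> + \<i> * P (\<lambda>T. v (insert f T)) \<eta>" for v
      using weight_poly_split[OF _ fU, of v "z \<eta>"] fin unfolding P_def V_def by (simp add: z_def)
    ultimately show ?thesis by simp
  qed
  have "0 \<le> Im ((of_real (weight_poly V w y) + \<i> * of_real (weight_poly V ?wf y)) *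
      cnj (of_real (weight_poly V ?we y) + \<i> * of_real (weight_poly V ?wef y)))"
  proof (rule tendsto_lowerbound)
    show "((\<lambda>\<eta>. Im ((P w \<eta> + \<i> * P ?wf \<eta>) * cnj (P ?we \<eta> + \<i> * P ?wef \<eta>))) \<longlongrightarrow>
       Im ((of_real (weight_poly V w y) + \<i> * of_real (weight_poly V ?wf y)) *
      cnj (of_real (weight_poly V ?we y) + \<i> * of_real (weight_poly V ?wef y)))) (at_right 0)"
      by (intro tendsto_intros lim)
    show "\<forall>\<^sub>F \<eta> in at_right 0. 0 \<le> Im ((P w \<eta> + \<i> * P ?wf \<eta>) * cnj (P ?we \<eta> + \<i> * P ?wef \<eta>))"
      using ineq by (auto simp: eventually_at_filter)
  qed auto
  then show ?thesis by (simp add: algebra_simps)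
qed

section \<open>Inclusion probabilities under external fields\<close>

text \<open>The probability that \<open>e\<close> belongs to a random set whose weight at \<open>T\<close> is proportional to \<open>w T\<close> times the
  product of the field \<open>y\<close> over \<open>T\<close>.\<close>
definition incl_prob :: "nat set \<Rightarrow> (nat set \<Rightarrow> real) \<Rightarrow> nat \<Rightarrow> (nat \<Rightarrow> real) \<Rightarrow> real" where
  "incl_prob U w e y = y e * weight_poly (U - {e}) (\<lambda>T. w (insert e T)) y / weight_poly U w y"

lemma incl_prob_cong:
  assumes "e \<in> U" "\<And>f. f \<in> U \<Longrightarrow> y f = z f" shows "incl_prob U w e y = incl_prob U w e z"
  unfolding incl_prob_def
  using assms weight_poly_cong[of U y z w] weight_poly_cong[of "U - {e}" y z "\<lambda>T. w (insert e T)"] by simp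

locale stable_weight =
  fixes U :: "nat set" and w :: "nat set \<Rightarrow> real"
  assumes fin: "finite U" and nonneg: "w T \<ge> 0" and stab: "half_plane_stable U w"
begin

lemma weight_poly_positive:
  fixes y :: "nat \<Rightarrow> real"
  assumes "\<And>e. e \<in> U \<Longrightarrow> y e > 0" shows "weight_poly U w y > 0"
proof -
  obtain T where T: "T \<subseteq> U" "w T \<noteq> 0" using stable_imp_weight[OF stab fin] by blast
  then show ?thesis using nonneg[of T] by (intro weight_poly_pos[OF fin nonneg, of T] assms) auto
qed

lemma incl_prob_raise_one:
  assumes ef: "e \<in> U" "f \<in> U" "e \<noteq> f" and y: "\<And>g. g \<in> U \<Longrightarrow> y g > 0" and t: "y f \<le> t"
  shows "incl_prob U w e (y(f := t)) \<le> incl_prob U w e y"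
proof -
  define V where "V = U - {e} - {f}"
  define a0 a1 b0 b1 where "a0 = weight_poly V w y" and "a1 = weight_poly V (\<lambda>T. w (insert f T)) y"
    and "b0 = weight_poly V (\<lambda>T. w (insert e T)) y" and "b1 = weight_poly V (\<lambda>T. w (insert e (insert f T))) y"
  have ray: "a0 * b1 \<le> a1 * b0"
    unfolding a0_def a1_def b0_def b1_def V_def by (rule rayleigh_inequality[OF stab fin ef])
  have expand: "weight_poly (U - {e}) v (y(f := x)) = weight_poly V v y + x * weight_poly V (\<lambda>T. v (insert f T)) y" for v x
  proof -
    have "weight_poly V v' (y(f := x)) = weight_poly V v' y" for v'
      by (rule weight_poly_cong) (auto simp: V_def)
    then show ?thesis
      using weight_poly_split[of "U - {e}" f v "y(f := x)"] fin ef unfolding V_def by simp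
  qed
  have con: "weight_poly (U - {e}) (\<lambda>T. w (insert e T)) (y(f := x)) = b0 + x * b1" for x
    using expand[of "\<lambda>T. w (insert e T)" x] by (simp add: b0_def b1_def)
  have tot: "weight_poly U w (y(f := x)) = (a0 + x * a1) + y e * (b0 + x * b1)" for x
    using weight_poly_split[OF fin ef(1), of w "y(f := x)"] con[of x] expand[of w x] ef
    by (simp add: a0_def a1_def)
  define s where "s = y f"
  have s: "y = y(f := s)" "s > 0" "s \<le> t" using y ef t by (auto simp: s_def)
  define D where "D = (\<lambda>x. (a0 + x * a1) + y e * (b0 + x * b1))"
  have D: "D x > 0" if "x > 0" for x
    unfolding D_def tot[symmetric] by (rule weight_poly_positive) (use y that in auto)
  have "0 \<le> y e * ((t - s) * (a1 * b0 - a0 * b1))"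
    using y[OF ef(1)] ray s by (intro mult_nonneg_nonneg) auto
  then have "y e * (b0 + t * b1) * D s \<le> y e * (b0 + s * b1) * D t"
    unfolding D_def by (simp add: algebra_simps)
  then have "y e * (b0 + t * b1) / D t \<le> y e * (b0 + s * b1) / D s"
    using D[of s] D[of t] s by (simp add: field_simps)
  moreover have "incl_prob U w e (y(f := x)) = y e * (b0 + x * b1) / D x" for x
    unfolding incl_prob_def con tot D_def using ef by simp
  ultimately show ?thesis using s(1) by metis
qed

lemma incl_prob_raise_others:
  assumes e: "e \<in> U" and y: "\<And>f. f \<in> U \<Longrightarrow> y f > 0" "y' e = y e" "\<And>f. f \<in> U \<Longrightarrow> y f \<le> y' f"
  shows "incl_prob U w e y' \<le> incl_prob U w e y"
proof -
  have "incl_prob U w e (\<lambda>g. if g \<in> F then y' g else y g) \<le> incl_prob U w e y"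
    if "finite F" "F \<subseteq> U - {e}" for F
    using that
  proof (induction F)
    case (insert f F)
    let ?z = "\<lambda>g. if g \<in> F then y' g else y g"
    have pos: "?z g > 0" if "g \<in> U" for g using y(1)[OF that] y(3)[OF that] by simp
    have "incl_prob U w e (?z(f := y' f)) \<le> incl_prob U w e ?z"
      by (rule incl_prob_raise_one[OF e]) (use insert pos y in auto)
    moreover have "?z(f := y' f) = (\<lambda>g. if g \<in> insert f F then y' g else y g)" by auto
    ultimately show ?case using insert by simp
  qed simp
  from this[of "U - {e}"] have "incl_prob U w e (\<lambda>g. if g \<in> U - {e} then y' g else y g) \<le> incl_prob U w e y"
    using fin by simp
  moreover have "incl_prob U w e (\<lambda>g. if g \<in> U - {e} then y' g else y g) = incl_prob U w e y'"
    by (rule incl_prob_cong[OF e]) (use y in auto)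
  ultimately show ?thesis by simp
qed

text \<open>Here stability enters beyond pairwise negative correlation: scaling the whole field by \<open>c\<close> also changes the
  field at \<open>e\<close>. Along the ray \<open>s \<mapsto> s y\<close> the inclusion probability divided by \<open>s y\<^sub>e\<close> is a
  function \<open>B/P\<close> that sends the upper half-plane to the closed lower one. Adding \<open>1/s\<close> makes this strict and only adds
  the constant \<open>1\<close> after multiplication by \<open>s\<close>, so \<open>slit_plane_monotone\<close> applies.\<close>
lemma incl_prob_scale:
  assumes e: "e \<in> U" and y: "\<And>f. f \<in> U \<Longrightarrow> y f > 0" and c: "0 < c" "c \<le> 1"
  shows "incl_prob U w e (\<lambda>f. c * y f) \<le> incl_prob U w e y"
proof -
  define B where "B = (\<lambda>s. weight_poly (U - {e}) (\<lambda>T. w (insert e T)) (\<lambda>f. s * of_real (y f) :: complex))"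
  define A where "A = (\<lambda>s. weight_poly (U - {e}) w (\<lambda>f. s * of_real (y f) :: complex))"
  define P where "P = (\<lambda>s. weight_poly U w (\<lambda>f. s * of_real (y f) :: complex))"
  define K where "K = (\<lambda>s. B s / P s + 1 / s)"
  define k where "k = (\<lambda>x. weight_poly (U - {e}) (\<lambda>T. w (insert e T)) (\<lambda>f. x * y f) / weight_poly U w (\<lambda>f. x * y f) + 1 / x)"
  have P_split: "P s = A s + s * of_real (y e) * B s" for s
    unfolding P_def A_def B_def by (rule weight_poly_split[OF fin e])
  have cnj: "B (cnj s) = cnj (B s)" "P (cnj s) = cnj (P s)" for s
    unfolding B_def P_def by (simp_all flip: weight_poly_cnj)
  have P_upper: "P s \<noteq> 0" if "Im s > 0" for s
    using stab that y unfolding half_plane_stable_def P_def by simp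
  have P_nz: "P s \<noteq> 0" if "s \<in> - \<real>\<^sub>\<le>\<^sub>0" for s
  proof -
    have "Im s \<noteq> 0 \<or> Re s > 0" using that by (auto simp: complex_nonpos_Reals_iff)
    then consider "Im s > 0" | "Im (cnj s) > 0" | "Im s = 0" "Re s > 0" by fastforce
    then show ?thesis
    proof cases
      case 2
      then show ?thesis using P_upper[OF 2] by (simp add: cnj)
    next
      case 3
      then have s: "s = of_real (Re s)" by (simp add: complex_eq_iff)
      have "P s = of_real (weight_poly U w (\<lambda>f. Re s * y f))"
        unfolding P_def by (subst s) (simp flip: weight_poly_of_real)
      moreover have "weight_poly U w (\<lambda>f. Re s * y f) > 0"
        by (rule weight_poly_positive) (use 3 y in auto)
      ultimately show ?thesis by simp
    qed (use P_upper in auto)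
  qed
  \<comment> \<open>since \<open>P = A + s y\<^sub>e B\<close>, the sign for \<open>B/P\<close> follows from the sign of \<open>Im (A cnj B)\<close>\<close>
  have K_upper: "Im (K s) < 0" if s: "Im s > 0" for s
  proof -
    have "Im (A s * cnj (B s)) \<ge> 0"
      unfolding A_def B_def by (rule stable_Im[OF stab fin e]) (use s y in auto)
    moreover have "Im (B s * cnj (P s)) = - Im (A s * cnj (B s)) - Im s * y e * (norm (B s))\<^sup>2"
      unfolding P_split cmod_power2 by (simp add: algebra_simps power2_eq_square)
    moreover have "Im s * y e * (norm (B s))\<^sup>2 \<ge> 0" using s y[OF e] by simp
    ultimately have "Im (B s * cnj (P s)) \<le> 0" by linarith
    moreover have "Im (B s / P s) = Im (B s * cnj (P s)) / (norm (P s))\<^sup>2"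
      by (subst complex_div_cnj) (metis Im_divide_of_real)
    ultimately have "Im (B s / P s) \<le> 0" by (simp add: divide_nonpos_nonneg)
    moreover have "s \<noteq> 0" using s by auto
    then have "Im (1 / s) < 0" using s by (simp add: Im_divide power2_eq_square divide_neg_pos sum_squares_gt_zero_iff complex_eq_iff)
    ultimately show ?thesis by (simp add: K_def)
  qed
  have K_cnj: "K (cnj s) = cnj (K s)" for s by (simp add: K_def cnj)
  have hol: "K holomorphic_on - \<real>\<^sub>\<le>\<^sub>0"
    unfolding K_def by (intro holomorphic_intros; (unfold B_def P_def weight_poly_def, intro holomorphic_intros)?)
      (use P_nz in \<open>auto simp: P_def weight_poly_def\<close>)
  have Pk: "weight_poly U w (\<lambda>f. x * y f) > 0" if "x > 0" for x
    by (rule weight_poly_positive) (use that y in auto)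
  have K_real: "K (of_real x) = of_real (k x)" for x
    unfolding K_def k_def B_def P_def by (simp flip: weight_poly_of_real)
  have k_pos: "k x > 0" if "x > 0" for x
    unfolding k_def using that y nonneg Pk[OF that]
    by (intro add_nonneg_pos divide_nonneg_pos weight_poly_nonneg) (auto simp: less_imp_le)
  have "c * k c \<le> 1 * k 1"
    by (rule slit_plane_monotone[OF hol K_upper _ K_real k_pos])
      (use c K_upper[of "cnj _"] K_cnj in auto)
  moreover have xk: "x * k x = incl_prob U w e (\<lambda>f. x * y f) / y e + 1" if "x > 0" for x
    using that y[OF e] by (simp add: k_def incl_prob_def field_simps)
  ultimately have "incl_prob U w e (\<lambda>f. c * y f) / y e \<le> incl_prob U w e y / y e"
    using c xk[of c] xk[of 1] by simp
  then show ?thesis using y[OF e] by (simp add: divide_le_cancel)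
qed

text \<open>Scale the whole field by \<open>c\<close>, then raise it away from \<open>e\<close>: both moves lower the probability of \<open>e\<close>.\<close>
lemma incl_prob_le:
  assumes e: "e \<in> U" and y: "\<And>f. f \<in> U \<Longrightarrow> y f > 0" and c: "0 < c" "c \<le> 1"
    and y': "y' e = c * y e" "\<And>f. f \<in> U \<Longrightarrow> c * y f \<le> y' f"
  shows "incl_prob U w e y' \<le> incl_prob U w e y"
proof -
  have "incl_prob U w e y' \<le> incl_prob U w e (\<lambda>f. c * y f)"
    by (rule incl_prob_raise_others[OF e]) (use y c y' in auto)
  also have "\<dots> \<le> incl_prob U w e y" by (rule incl_prob_scale[OF e _ c]) (rule y)
  finally show ?thesis .
qed

lemma weight_poly_scale_one:
  assumes e: "e \<in> U" and y: "\<And>f. f \<in> U \<Longrightarrow> y f > 0"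
  shows "weight_poly U w (y(e := r * y e)) = weight_poly U w y * (1 - (1 - r) * incl_prob U w e y)"
proof -
  have c: "weight_poly (U - {e}) v (y(e := r * y e)) = weight_poly (U - {e}) v y" for v
    by (rule weight_poly_cong) auto
  have "weight_poly U w y > 0" by (rule weight_poly_positive[OF y])
  then show ?thesis
    using weight_poly_split[OF fin e, of w "y(e := r * y e)"] weight_poly_split[OF fin e, of w y]
    by (simp add: incl_prob_def c field_simps)
qed

text \<open>With \<open>E\<close> the expectation under the normalised weight \<open>w\<close>, this is a correlation inequality: the tilt by
  \<open>r\<close> on \<open>Q\<close> and the field \<open>y\<close> are positively correlated. The elements of \<open>Q\<close> are tilted one at a time. Each
  tilt multiplies the polynomial by \<open>1 - (1 - r) \<pi>\<close>, where \<open>\<pi>\<close> is the current probability of that element, and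
  \<open>incl_prob_le\<close> compares \<open>\<pi>\<close> with and without the field \<open>y\<close>. The two alternatives in \<open>side\<close> serve for
  values below and above \<open>1\<close>.\<close>
lemma weight_poly_peel:
  fixes y :: "nat \<Rightarrow> real" and c r :: real
  defines "tilt \<equiv> \<lambda>Q z f. if f \<in> Q then r * z f else z f"
  assumes Q: "Q \<subseteq> U" and y: "\<And>f. f \<in> U \<Longrightarrow> y f > 0" and r: "r > 0"
    and yQ: "\<And>f. f \<in> Q \<Longrightarrow> y f = c"
    and side: "(r \<le> 1 \<and> c \<le> 1 \<and> (\<forall>f\<in>U. c \<le> y f)) \<or> (1 \<le> r \<and> 1 \<le> c \<and> (\<forall>f\<in>U. y f \<le> c))"
  shows "weight_poly U w y * weight_poly U w (tilt Q (\<lambda>_. 1)) \<le> weight_poly U w (tilt Q y) * weight_poly U w (\<lambda>_. 1)"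
proof -
  have "finite Q" using Q fin finite_subset by auto
  then show ?thesis using Q yQ
  proof (induction Q)
    case empty
    then show ?case by (simp add: tilt_def)
  next
    case (insert e Q)
    let ?g = "weight_poly U w :: (nat \<Rightarrow> real) \<Rightarrow> real" and ?i = "incl_prob U w e"
    define a b where "a = tilt Q (\<lambda>_. 1 :: real)" and "b = tilt Q y"
    have e: "e \<in> U" "y e = c" "e \<notin> Q" using insert by auto
    have "c > 0" using y e by metis
    have ab: "a f > 0" "b f > 0" if "f \<in> U" for f using that r y by (auto simp: a_def b_def tilt_def)
    have ae: "a e = 1" "b e = c" using e by (auto simp: a_def b_def tilt_def)
    have b': "tilt (insert e Q) y = b(e := r * b e)" and a': "tilt (insert e Q) (\<lambda>_. 1) = a(e := r * a e)"
      using e by (auto simp: a_def b_def tilt_def)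
    have mono: "(1 - r) * ?i b \<le> (1 - r) * ?i a"
    proof (cases "r \<le> 1 \<and> c \<le> 1 \<and> (\<forall>f\<in>U. c \<le> y f)")
      case True
      then have "?i b \<le> ?i a"
        using ab ae \<open>c > 0\<close> r
        by (intro incl_prob_le[OF e(1), of a c b]) (auto simp: a_def b_def tilt_def)
      then show ?thesis using True by (simp add: mult_left_mono)
    next
      case False
      then have F: "1 \<le> r" "1 \<le> c" "\<And>f. f\<in>U \<Longrightarrow> y f \<le> c" using side by auto
      have "?i a \<le> ?i b"
        using ab ae F r
        by (intro incl_prob_le[OF e(1), of b "1 / c" a]) (auto simp: a_def b_def tilt_def field_simps)
      then show ?thesis using F by (simp add: mult_left_mono_neg)
    qed
    have IH: "?g y * ?g a \<le> ?g b * ?g (\<lambda>_. 1)"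
      using insert by (auto simp: a_def b_def)
    have pos: "?g a > 0" "?g b > 0" "?g (a(e := r * a e)) > 0" "?g (\<lambda>_. 1) > 0" "?g y > 0"
      using ab r e by (simp_all add: weight_poly_positive y)
    have sca: "?g (a(e := r * a e)) = ?g a * (1 - (1 - r) * ?i a)"
      and scb: "?g (b(e := r * b e)) = ?g b * (1 - (1 - r) * ?i b)"
      by (rule weight_poly_scale_one[OF e(1)], rule ab, assumption)+
    have fac: "1 - (1 - r) * ?i a \<ge> 0"
      using pos sca by (simp add: zero_less_mult_iff)
    have "?g y * ?g (a(e := r * a e)) = (?g y * ?g a) * (1 - (1 - r) * ?i a)"
      using sca by simp
    also have "\<dots> \<le> (?g b * ?g (\<lambda>_. 1)) * (1 - (1 - r) * ?i b)"
      using fac mono pos by (intro mult_mono[OF IH]) auto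
    also have "\<dots> = ?g (b(e := r * b e)) * ?g (\<lambda>_. 1)"
      using scb by simp
    finally show ?case unfolding a' b' .
  qed
qed

end

section \<open>Univariate polynomials without zeros in a half-plane\<close>

text \<open>The fundamental theorem of algebra as an induction principle.\<close>
lemma complex_poly_root_induct [case_names const root]:
  fixes p :: "complex poly"
  assumes "\<And>c. Q [:c:]" "\<And>r p. Q p \<Longrightarrow> Q ([:r, -1:] * p)"
  shows "Q p"
proof (induction p rule: poly_root_induct[of _ "\<lambda>_. True"])
  case (no_roots p)
  then obtain c where "p = [:c:]" using fundamental_theorem_of_algebra_alt[of p] by auto
  then show ?case using assms(1)[of c] by simp
next
  case 0
  then show ?case using assms(1)[of 0] by simp
next
  case (root r p)
  show ?case by (rule assms(2)[OF root(2)])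
qed

lemma poly_pderiv_root_factor:
  fixes p :: "complex poly"
  shows "poly (pderiv ([:r, -1:] * p)) z = (r - z) * poly (pderiv p) z - poly p z"
  unfolding pderiv_mult by (simp add: pderiv_pCons algebra_simps)

text \<open>The logarithmic derivative is a sum of terms \<open>1 / (t - r)\<close> over the roots, each with negative imaginary part.
  The case \<open>\<zeta> = 0\<close> is that of a constant polynomial.\<close>
lemma gauss_lucas_upper:
  fixes q :: "complex poly"
  assumes "\<And>s. Im s > 0 \<Longrightarrow> poly q s \<noteq> 0" "Im t > 0"
  shows "\<exists>\<zeta>. poly (pderiv q) t = poly q t * \<zeta> \<and> (\<zeta> = 0 \<or> Im \<zeta> < 0)"
  using assms(1)
proof (induction q rule: complex_poly_root_induct)
  case (const c)
  then show ?case by (intro exI[of _ 0]) (simp add: pderiv_pCons)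
next
  case (root r p)
  have "poly p s \<noteq> 0" if "Im s > 0" for s using root.prems[OF that] by auto
  from root.IH[OF this] obtain \<zeta> where \<zeta>: "poly (pderiv p) t = poly p t * \<zeta>" "\<zeta> = 0 \<or> Im \<zeta> < 0"
    by blast
  have "Im r \<le> 0" using root.prems[of r] by force
  then have rt: "Im (t - r) > 0" using assms(2) by simp
  then have "t - r \<noteq> 0" by auto
  have "Im (1 / (t - r)) < 0"
    using rt \<open>t - r \<noteq> 0\<close> by (auto simp: Im_divide complex_eq_iff intro!: divide_neg_pos sum_power2_gt_zero_iff[THEN iffD2])
  then have "Im (\<zeta> + 1 / (t - r)) < 0" using \<zeta>(2) by auto
  moreover have "poly (pderiv ([:r, -1:] * p)) t = poly ([:r, -1:] * p) t * (\<zeta> + 1 / (t - r))"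
    unfolding poly_pderiv_root_factor using \<zeta>(1) \<open>t - r \<noteq> 0\<close> by (simp add: field_simps)
  ultimately show ?case by blast
qed

text \<open>The reason for working with \<open>\<epsilon> + d/dt\<close> instead of \<open>d/dt\<close>: there is no exceptional case in which
  the result vanishes.\<close>
lemma gauss_lucas_shifted:
  fixes q :: "complex poly" and \<epsilon> :: real
  assumes "\<And>s. Im s > 0 \<Longrightarrow> poly q s \<noteq> 0" "Im t > 0" "\<epsilon> > 0"
  shows "of_real \<epsilon> * poly q t + poly (pderiv q) t \<noteq> 0"
proof -
  obtain \<zeta> where \<zeta>: "poly (pderiv q) t = poly q t * \<zeta>" "\<zeta> = 0 \<or> Im \<zeta> < 0"
    using gauss_lucas_upper[OF assms(1,2)] by blast
  have "of_real \<epsilon> + \<zeta> \<noteq> 0" using \<zeta>(2) assms(3) by (auto simp: complex_eq_iff)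
  moreover have "of_real \<epsilon> * poly q t + poly (pderiv q) t = poly q t * (of_real \<epsilon> + \<zeta>)"
    using \<zeta>(1) by (simp add: algebra_simps)
  ultimately show ?thesis using assms(1)[OF assms(2)] by simp
qed

text \<open>Each linear factor satisfies \<open>1 - \<tau>/\<rho> \<le> exp (-\<tau>/\<rho>)\<close>, and its left-hand side is positive because the
  root \<open>\<rho>\<close> does not lie between \<open>0\<close> and \<open>\<tau>\<close>.\<close>
lemma real_rooted_tangent:
  fixes q :: "complex poly" and \<tau> :: real
  assumes "\<And>z. poly q z = 0 \<Longrightarrow> Im z = 0 \<and> Re z \<notin> closed_segment 0 \<tau>"
  shows "norm (poly q (of_real \<tau>)) \<le> norm (poly q 0) * exp (\<tau> * Re (poly (pderiv q) 0 / poly q 0))"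
  using assms
proof (induction q rule: complex_poly_root_induct)
  case (const c)
  then show ?case by (simp add: pderiv_pCons)
next
  case (root r p)
  have "poly p z = 0 \<Longrightarrow> Im z = 0 \<and> Re z \<notin> closed_segment 0 \<tau>" for z using root.prems[of z] by auto
  note IH = root.IH[OF this]
  have r: "Im r = 0" "Re r \<notin> closed_segment 0 \<tau>" using root.prems[of r] by auto
  define \<rho> where "\<rho> = Re r"
  have r_eq: "r = of_real \<rho>" using r by (simp add: \<rho>_def complex_eq_iff)
  have seg: "\<rho> \<noteq> 0" "1 - \<tau> / \<rho> > 0"
  proof -
    show "\<rho> \<noteq> 0" using r by (auto simp: \<rho>_def)
    then show "1 - \<tau> / \<rho> > 0" using r(2)
      by (auto simp: \<rho>_def[symmetric] closed_segment_eq_real_ivl field_simps split: if_splits)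
  qed
  have p0: "poly p 0 \<noteq> 0"
  proof
    assume "poly p 0 = 0"
    then show False using root.prems[of 0] by simp
  qed
  have "norm (poly ([:r, -1:] * p) (of_real \<tau>)) = \<bar>\<rho> - \<tau>\<bar> * norm (poly p (of_real \<tau>))"
  proof -
    have "poly ([:r, -1:] * p) (of_real \<tau>) = of_real (\<rho> - \<tau>) * poly p (of_real \<tau>)"
      by (simp add: r_eq algebra_simps)
    then show ?thesis by (simp only: norm_mult norm_of_real)
  qed
  also have "\<bar>\<rho> - \<tau>\<bar> = \<bar>\<rho>\<bar> * (1 - \<tau> / \<rho>)"
  proof -
    have "\<rho> - \<tau> = \<rho> * (1 - \<tau> / \<rho>)" using seg(1) by (simp add: field_simps)
    then show ?thesis using seg(2) by (metis abs_mult abs_of_pos)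
  qed
  also have "\<bar>\<rho>\<bar> * (1 - \<tau> / \<rho>) * norm (poly p (of_real \<tau>))
      \<le> \<bar>\<rho>\<bar> * exp (- (\<tau> / \<rho>)) * (norm (poly p 0) * exp (\<tau> * Re (poly (pderiv p) 0 / poly p 0)))"
    using exp_ge_add_one_self[of "- (\<tau> / \<rho>)"] seg
    by (intro mult_mono IH) auto
  also have "\<dots> = norm (poly ([:r, -1:] * p) 0) * exp (\<tau> * (Re (poly (pderiv p) 0 / poly p 0) - 1 / \<rho>))"
    by (simp add: r_eq norm_mult right_diff_distrib exp_diff exp_minus field_simps)
  also have "Re (poly (pderiv p) 0 / poly p 0) - 1 / \<rho> = Re (poly (pderiv ([:r, -1:] * p)) 0 / poly ([:r, -1:] * p) 0)"
  proof -
    have "poly (pderiv ([:r, -1:] * p)) 0 / poly ([:r, -1:] * p) 0 = poly (pderiv p) 0 / poly p 0 - of_real (1 / \<rho>)"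
      unfolding poly_pderiv_root_factor using seg p0 by (simp add: r_eq field_simps)
    then show ?thesis by simp
  qed
  finally show ?case .
qed

lemma power_le_scaled_exp:
  fixes u :: real
  assumes "u \<ge> 0" shows "u ^ k \<le> real k ^ k * exp (- real k) * exp u"
proof (cases "k = 0")
  case False
  have "u / real k \<le> exp (u / real k - 1)" using exp_ge_add_one_self[of "u / real k - 1"] by simp
  then have "(u / real k) ^ k \<le> exp (u / real k - 1) ^ k" using assms by (intro power_mono) auto
  also have "\<dots> = exp (u - real k)" using False by (subst exp_of_nat_mult[symmetric]) (simp add: field_simps)
  finally show ?thesis using False by (simp add: power_divide exp_diff exp_minus field_simps)
qed (use assms in simp)

text \<open>The polynomial \<open>(\<epsilon> + d/dt)\<^sup>k t\<^sup>m\<close>. The recursion applies the innermost operator first, which keeps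
  every value in the family. For \<open>m = 0\<close> the second summand vanishes, so the truncated predecessor is harmless.\<close>
fun diff_pow :: "real \<Rightarrow> nat \<Rightarrow> nat \<Rightarrow> 'a::real_normed_field poly" where
  "diff_pow \<epsilon> 0 m = monom 1 m"
| "diff_pow \<epsilon> (Suc k) m = smult (of_real \<epsilon>) (diff_pow \<epsilon> k m) + smult (of_nat m) (diff_pow \<epsilon> k (m - 1))"

lemma pderiv_diff_pow: "pderiv (diff_pow \<epsilon> k m) = smult (of_nat m) (diff_pow \<epsilon> k (m - 1))"
  by (induction k arbitrary: m)
     (simp_all add: pderiv_monom pderiv_add pderiv_smult smult_add_right smult_monom mult.commute)

lemma poly_diff_pow_of_real: "poly (diff_pow \<epsilon> k m) (of_real x) = of_real (poly (diff_pow \<epsilon> k m) x)"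
  by (induction k arbitrary: m) (simp_all add: poly_monom)

lemma poly_diff_pow_cnj: "poly (diff_pow \<epsilon> k m) (cnj z) = cnj (poly (diff_pow \<epsilon> k m) z)"
  by (induction k arbitrary: m) (simp_all add: poly_monom)

lemma poly_diff_pow_pos:
  fixes x :: real assumes "\<epsilon> > 0" "x > 0" shows "poly (diff_pow \<epsilon> k m) x > 0"
  using assms
proof (induction k arbitrary: m)
  case (Suc k)
  then show ?case using less_imp_le[OF Suc.IH] by (auto intro!: add_pos_nonneg)
qed (simp add: poly_monom)

lemma diff_pow_limit:
  "((\<lambda>\<epsilon>. poly (diff_pow \<epsilon> k m) \<epsilon>) \<longlongrightarrow> (if m = k then fact k else 0 :: real)) (at_right 0)"
proof (induction k arbitrary: m)
  case 0
  have "((\<lambda>\<epsilon>::real. \<epsilon> ^ m) \<longlongrightarrow> 0 ^ m) (at_right 0)" by (intro tendsto_intros)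
  then show ?case by (simp add: poly_monom power_0_left)
next
  case (Suc k)
  have "((\<lambda>\<epsilon>. \<epsilon> * poly (diff_pow \<epsilon> k m) \<epsilon> + real m * poly (diff_pow \<epsilon> k (m - 1)) \<epsilon>) \<longlongrightarrow>
      0 * (if m = k then fact k else 0) + real m * (if m - 1 = k then fact k else 0)) (at_right 0)"
    by (intro tendsto_intros Suc)
  moreover have "0 * (if m = k then fact k else 0) + real m * (if m - 1 = k then fact k else 0)
     = (if m = Suc k then fact (Suc k) else 0)" by (cases m) auto
  ultimately show ?case by simp
qed

lemma pderiv_sum_poly: "pderiv (\<Sum>a\<in>A. f a) = (\<Sum>a\<in>A. pderiv (f a))"
  by (induction A rule: infinite_finite_induct) (auto simp: pderiv_add)

section \<open>A coefficient is bounded below by the capacity\<close>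

text \<open>The ground set is partitioned into blocks by the map \<open>blk\<close>. In the application the
  elements outside all the given sets form a block of their own, so that every element can carry a variable in the upper half-plane.\<close>
locale block_weight = stable_weight +
  fixes I :: "nat set" and blk :: "nat \<Rightarrow> nat"
  assumes finI: "finite I" and blk: "e \<in> U \<Longrightarrow> blk e \<in> I"
begin

definition block_count :: "nat set \<Rightarrow> nat \<Rightarrow> nat" where "block_count T i = card {e\<in>T. blk e = i}"

text \<open>The operators \<open>(\<epsilon> + \<partial>\<^sub>i)\<close>, each to the power \<open>\<alpha> i\<close>, applied to the block polynomial.\<close>
definition shifted_poly :: "real \<Rightarrow> (nat \<Rightarrow> nat) \<Rightarrow> (nat \<Rightarrow> 'a::real_normed_field) \<Rightarrow> 'a" where
  "shifted_poly \<epsilon> \<alpha> z = (\<Sum>T\<in>Pow U. of_real (w T) * (\<Prod>i\<in>I. poly (diff_pow \<epsilon> (\<alpha> i) (block_count T i)) (z i)))"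

text \<open>\<open>shifted_poly\<close> as a univariate polynomial in coordinate \<open>j\<close>, the others being fixed at \<open>z\<close>.\<close>
definition coord_poly :: "real \<Rightarrow> (nat \<Rightarrow> nat) \<Rightarrow> nat \<Rightarrow> (nat \<Rightarrow> 'a::real_normed_field) \<Rightarrow> 'a poly" where
  "coord_poly \<epsilon> \<alpha> j z = (\<Sum>T\<in>Pow U. smult (of_real (w T) * (\<Prod>i\<in>I-{j}. poly (diff_pow \<epsilon> (\<alpha> i) (block_count T i)) (z i)))
      (diff_pow \<epsilon> (\<alpha> j) (block_count T j)))"

lemma prod_by_blocks:
  assumes "T \<subseteq> U" shows "(\<Prod>e\<in>T. z (blk e)) = (\<Prod>i\<in>I. z i ^ block_count T i)"
proof -
  have T: "finite T" "blk ` T \<subseteq> I" using assms fin blk finite_subset by auto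
  have "(\<Prod>e\<in>T. z (blk e)) = (\<Prod>i\<in>I. \<Prod>e\<in>{e\<in>T. blk e = i}. z (blk e))"
    using prod.group[OF T(1) finI T(2), of "\<lambda>e. z (blk e)"] by simp
  also have "\<dots> = (\<Prod>i\<in>I. z i ^ block_count T i)"
    by (intro prod.cong refl) (simp add: block_count_def)
  finally show ?thesis .
qed

lemma weight_poly_blk: "weight_poly U w (\<lambda>e. z (blk e)) = (\<Sum>T\<in>Pow U. of_real (w T) * (\<Prod>i\<in>I. z i ^ block_count T i))"
  unfolding weight_poly_def by (intro sum.cong refl) (simp add: prod_by_blocks)

lemma shifted_poly_0: "shifted_poly \<epsilon> (\<lambda>_. 0) z = weight_poly U w (\<lambda>e. z (blk e))"
  by (simp add: shifted_poly_def weight_poly_blk poly_monom)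

lemma shifted_poly_cong: "(\<And>i. i \<in> I \<Longrightarrow> \<alpha> i = \<beta> i) \<Longrightarrow> shifted_poly \<epsilon> \<alpha> z = shifted_poly \<epsilon> \<beta> z"
  unfolding shifted_poly_def by (intro sum.cong refl) (simp cong: prod.cong)

lemma shifted_poly_of_real: "shifted_poly \<epsilon> \<alpha> (\<lambda>i. of_real (x i)) = of_real (shifted_poly \<epsilon> \<alpha> x)"
  by (simp add: shifted_poly_def poly_diff_pow_of_real)

lemma shifted_poly_cnj: "shifted_poly \<epsilon> \<alpha> (\<lambda>i. cnj (z i)) = cnj (shifted_poly \<epsilon> \<alpha> z)"
  by (simp add: shifted_poly_def poly_diff_pow_cnj)

lemma prod_split_block: "j \<in> I \<Longrightarrow> (\<Prod>i\<in>I. f i) = (\<Prod>i\<in>I-{j}. f i) * f j" for f :: "nat \<Rightarrow> 'a::comm_monoid_mult"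
  using prod.remove[OF finI, of j f] by (simp add: mult.commute)

lemma poly_coord_poly:
  assumes "j \<in> I" shows "poly (coord_poly \<epsilon> \<alpha> j z) t = shifted_poly \<epsilon> \<alpha> (z(j := t))"
proof -
  have "(\<Prod>i\<in>I. poly (d i) ((z(j := t)) i)) = (\<Prod>i\<in>I-{j}. poly (d i) (z i)) * poly (d j) t"
    for d :: "nat \<Rightarrow> 'a poly"
    unfolding prod_split_block[OF assms] by (intro arg_cong2[of _ _ _ _ "(*)"] prod.cong) auto
  then show ?thesis unfolding coord_poly_def shifted_poly_def poly_sum by (simp add: mult.assoc del: fun_upd_apply)
qed

lemma shifted_poly_Suc:
  assumes "j \<in> I"
  shows "shifted_poly \<epsilon> (\<alpha>(j := Suc (\<alpha> j))) (z(j := t)) = of_real \<epsilon> * poly (coord_poly \<epsilon> \<alpha> j z) t + poly (pderiv (coord_poly \<epsilon> \<alpha> j z)) t"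
proof -
  have "shifted_poly \<epsilon> (\<alpha>(j := Suc (\<alpha> j))) (z(j := t))
    = (\<Sum>T\<in>Pow U. of_real (w T) * (\<Prod>i\<in>I-{j}. poly (diff_pow \<epsilon> (\<alpha> i) (block_count T i)) (z i)) *
        (of_real \<epsilon> * poly (diff_pow \<epsilon> (\<alpha> j) (block_count T j)) t + poly (pderiv (diff_pow \<epsilon> (\<alpha> j) (block_count T j))) t))"
  proof -
    have "(\<Prod>i\<in>I. poly (diff_pow \<epsilon> ((\<alpha>(j := Suc (\<alpha> j))) i) (c i)) ((z(j := t)) i))
        = (\<Prod>i\<in>I-{j}. poly (diff_pow \<epsilon> (\<alpha> i) (c i)) (z i)) * poly (diff_pow \<epsilon> (Suc (\<alpha> j)) (c j)) t" for c
      unfolding prod_split_block[OF assms] by (intro arg_cong2[of _ _ _ _ "(*)"] prod.cong) auto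
    then show ?thesis unfolding shifted_poly_def by (simp add: mult.assoc pderiv_diff_pow del: fun_upd_apply)
  qed
  also have "\<dots> = of_real \<epsilon> * poly (coord_poly \<epsilon> \<alpha> j z) t + poly (pderiv (coord_poly \<epsilon> \<alpha> j z)) t"
    by (simp add: coord_poly_def pderiv_sum_poly poly_sum pderiv_smult distrib_left sum.distrib sum_distrib_left mult_ac)
  finally show ?thesis .
qed

text \<open>One operator \<open>\<epsilon> + \<partial>\<^sub>j\<close> at a time, by \<open>gauss_lucas_shifted\<close> on the line of coordinate \<open>j\<close>.\<close>
lemma shifted_poly_nonzero:
  assumes "\<epsilon> > 0" "\<And>i. i \<in> I \<Longrightarrow> Im (z i) > 0"
  shows "shifted_poly \<epsilon> \<alpha> z \<noteq> 0"
  using assms(2)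
proof (induction "\<Sum>i\<in>I. \<alpha> i" arbitrary: \<alpha> z)
  case 0
  then have "shifted_poly \<epsilon> \<alpha> z = shifted_poly \<epsilon> (\<lambda>_. 0) z" using finI by (intro shifted_poly_cong) simp
  then show ?case using stab blk 0 by (simp add: shifted_poly_0 half_plane_stable_def)
next
  case (Suc s)
  then obtain j where j: "j \<in> I" "\<alpha> j \<noteq> 0" using finI by (metis sum.neutral nat.simps(3))
  define \<beta> where "\<beta> = \<alpha>(j := \<alpha> j - 1)"
  have \<alpha>: "\<alpha> = \<beta>(j := Suc (\<beta> j))" using j by (auto simp: \<beta>_def)
  have "(\<Sum>i\<in>I. \<alpha> i) = Suc (\<Sum>i\<in>I. \<beta> i)"
    using finI j(1) by (subst \<alpha>) (simp add: sum.remove[of I j])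
  then have IH: "shifted_poly \<epsilon> \<beta> y \<noteq> 0" if "\<And>i. i \<in> I \<Longrightarrow> Im (y i) > 0" for y
    using Suc.hyps that by auto
  have "poly (coord_poly \<epsilon> \<beta> j z) s \<noteq> 0" if "Im s > 0" for s
    unfolding poly_coord_poly[OF j(1)] by (rule IH) (use that Suc.prems in auto)
  then have "of_real \<epsilon> * poly (coord_poly \<epsilon> \<beta> j z) (z j) + poly (pderiv (coord_poly \<epsilon> \<beta> j z)) (z j) \<noteq> 0"
    by (rule gauss_lucas_shifted) (use Suc.prems j assms in auto)
  then show ?case using shifted_poly_Suc[OF j(1), of \<epsilon> \<beta> z "z j"] \<alpha> by simp
qed

lemma shifted_poly_pos:
  assumes "\<epsilon> > 0" "\<And>i. i \<in> I \<Longrightarrow> x i > (0::real)" shows "shifted_poly \<epsilon> \<alpha> x > 0"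
proof -
  obtain T where T: "T \<in> Pow U" "w T \<noteq> 0" using stable_imp_weight[OF stab fin] by blast
  have P: "(\<Prod>i\<in>I. poly (diff_pow \<epsilon> (\<alpha> i) (block_count S i)) (x i)) > 0" for S
    using assms by (intro prod_pos ballI poly_diff_pow_pos) auto
  have "0 < of_real (w T) * (\<Prod>i\<in>I. poly (diff_pow \<epsilon> (\<alpha> i) (block_count T i)) (x i))"
    using P T nonneg[of T] by simp
  also have "\<dots> \<le> shifted_poly \<epsilon> \<alpha> x" unfolding shifted_poly_def
    by (rule member_le_sum[OF T(1)]) (use P nonneg fin less_imp_le[OF P] in auto)
  finally show ?thesis .
qed

lemma coord_poly_deriv_nonneg:
  assumes "\<epsilon> > 0" "\<And>i. i \<in> I \<Longrightarrow> x i > (0::real)" "j \<in> I"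
  shows "poly (pderiv (coord_poly \<epsilon> \<alpha> j x)) (x j) \<ge> 0"
proof -
  have "poly (diff_pow \<epsilon> k m) (x i) \<ge> 0" if "i \<in> I" for k m i
    using poly_diff_pow_pos[OF assms(1) assms(2)[OF that]] by (rule less_imp_le)
  then show ?thesis
    unfolding coord_poly_def pderiv_sum_poly poly_sum pderiv_smult pderiv_diff_pow using nonneg assms(3)
    by (intro sum_nonneg) (auto intro!: mult_nonneg_nonneg prod_nonneg)
qed

text \<open>Stability controls zeros only along directions with positive entries, so the tangent inequality is proved for
  the direction with entry \<open>1\<close> at \<open>j\<close> and \<open>\<eta>\<close> elsewhere, and then \<open>\<eta>\<close> tends to \<open>0\<close>.\<close>
lemma shifted_poly_tangent:
  assumes \<epsilon>: "\<epsilon> > 0" and x: "\<And>i. i \<in> I \<Longrightarrow> x i > (0::real)" and j: "j \<in> I" and t: "t > 0"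
  shows "shifted_poly \<epsilon> \<alpha> (x(j := t)) \<le> shifted_poly \<epsilon> \<alpha> x * exp ((t - x j) * (poly (pderiv (coord_poly \<epsilon> \<alpha> j x)) (x j) / shifted_poly \<epsilon> \<alpha> x))"
proof -
  define \<tau> where "\<tau> = t - x j"
  define v where "v = (\<lambda>(\<eta>::real) i. if i = j then 1 else \<eta>)"
  define L where "L = (\<lambda>T i. diff_pow \<epsilon> (\<alpha> i) (block_count T i) :: real poly)"
  define G where "G = (\<lambda>\<eta>. \<Sum>T\<in>Pow U. w T * (\<Sum>i\<in>I. (\<Prod>k\<in>I-{i}. poly (L T k) (x k)) * (poly (pderiv (L T i)) (x i) * v \<eta> i)))"
  \<comment> \<open>the smallness of \<open>\<eta>\<close> keeps the whole segment inside the positive orthant\<close>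
  have ineq: "shifted_poly \<epsilon> \<alpha> (\<lambda>i. x i + \<tau> * v \<eta> i) \<le> shifted_poly \<epsilon> \<alpha> x * exp (\<tau> * (G \<eta> / shifted_poly \<epsilon> \<alpha> x))"
    if \<eta>: "\<eta> > 0" "\<forall>i\<in>I. \<eta> * \<bar>\<tau>\<bar> < x i" for \<eta>
  proof -
    define \<psi> :: "complex poly" where "\<psi> = (\<Sum>T\<in>Pow U. smult (of_real (w T))
      (\<Prod>i\<in>I. pcompose (diff_pow \<epsilon> (\<alpha> i) (block_count T i)) [:of_real (x i), of_real (v \<eta> i):]))"
    have \<psi>: "poly \<psi> z = shifted_poly \<epsilon> \<alpha> (\<lambda>i. of_real (x i) + z * of_real (v \<eta> i))" for z
      by (simp add: \<psi>_def shifted_poly_def poly_sum poly_prod poly_pcompose)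
    have v: "v \<eta> i > 0" for i using \<eta> by (simp add: v_def)
    have \<psi>_real: "poly \<psi> (of_real s) = of_real (shifted_poly \<epsilon> \<alpha> (\<lambda>i. x i + s * v \<eta> i))" for s
      unfolding \<psi> by (simp flip: shifted_poly_of_real)
    have pos: "x i + s * v \<eta> i > 0" if s: "s \<in> closed_segment 0 \<tau>" and "i \<in> I" for s i
    proof (cases "i = j")
      case True
      then show ?thesis using s t x[OF j] unfolding \<tau>_def v_def
        by (auto simp: closed_segment_eq_real_ivl split: if_splits)
    next
      case False
      have "\<bar>s\<bar> \<le> \<bar>\<tau>\<bar>" using s by (auto simp: closed_segment_eq_real_ivl split: if_splits)
      then have "\<bar>s * \<eta>\<bar> \<le> \<eta> * \<bar>\<tau>\<bar>" using \<eta>(1) by (simp add: abs_mult mult.commute mult_left_mono)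
      then show ?thesis using \<eta>(2) \<open>i \<in> I\<close> False by (force simp: v_def)
    qed
    have roots: "Im z = 0 \<and> Re z \<notin> closed_segment 0 \<tau>" if "poly \<psi> z = 0" for z
    proof
      show im: "Im z = 0"
      proof (rule ccontr)
        assume "Im z \<noteq> 0"
        then consider "Im z > 0" | "Im (cnj z) > 0" by fastforce
        then show False
        proof cases
          case 1
          have "poly \<psi> z \<noteq> 0" unfolding \<psi> by (rule shifted_poly_nonzero[OF \<epsilon>]) (use 1 v in simp)
          then show False using that by simp
        next
          case 2
          have "poly \<psi> (cnj z) = cnj (poly \<psi> z)" unfolding \<psi> by (simp flip: shifted_poly_cnj)
          moreover have "poly \<psi> (cnj z) \<noteq> 0" unfolding \<psi> by (rule shifted_poly_nonzero[OF \<epsilon>]) (use 2 v in \<open>simp add: mult_neg_pos\<close>)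
          ultimately show False using that by simp
        qed
      qed
      show "Re z \<notin> closed_segment 0 \<tau>"
      proof
        assume z: "Re z \<in> closed_segment 0 \<tau>"
        have "z = of_real (Re z)" using im by (simp add: complex_eq_iff)
        then have "shifted_poly \<epsilon> \<alpha> (\<lambda>i. x i + Re z * v \<eta> i) = 0" using that \<psi>_real[of "Re z"] by simp
        moreover have "shifted_poly \<epsilon> \<alpha> (\<lambda>i. x i + Re z * v \<eta> i) > 0" by (rule shifted_poly_pos[OF \<epsilon>]) (rule pos[OF z])
        ultimately show False by simp
      qed
    qed
    have "poly (pderiv \<psi>) 0 = of_real (G \<eta>)"
      unfolding \<psi>_def G_def L_def pderiv_sum_poly pderiv_smult pderiv_prod pderiv_pcompose
      by (simp add: poly_sum poly_prod poly_pcompose pderiv_pCons pderiv_diff_pow poly_diff_pow_of_real mult_ac)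
    moreover have "poly \<psi> 0 = of_real (shifted_poly \<epsilon> \<alpha> x)" using \<psi>_real[of 0] by simp
    moreover have "shifted_poly \<epsilon> \<alpha> x > 0" "shifted_poly \<epsilon> \<alpha> (\<lambda>i. x i + \<tau> * v \<eta> i) > 0"
      by (rule shifted_poly_pos[OF \<epsilon>], use x pos in auto)+
    moreover have "norm (poly \<psi> (of_real \<tau>)) \<le> norm (poly \<psi> 0) * exp (\<tau> * Re (poly (pderiv \<psi>) 0 / poly \<psi> 0))"
      by (rule real_rooted_tangent) (rule roots)
    ultimately show ?thesis using \<psi>_real[of \<tau>] by simp
  qed
  have Hx: "shifted_poly \<epsilon> \<alpha> x > 0" by (rule shifted_poly_pos[OF \<epsilon>]) (rule x)
  have lim_v: "((\<lambda>\<eta>. v \<eta> i) \<longlongrightarrow> (if i = j then 1 else 0)) (at_right 0)" for i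
    by (cases "i = j") (auto simp: v_def intro: tendsto_ident_at)
  have lim1: "((\<lambda>\<eta>. shifted_poly \<epsilon> \<alpha> (\<lambda>i. x i + \<tau> * v \<eta> i)) \<longlongrightarrow> shifted_poly \<epsilon> \<alpha> (\<lambda>i. x i + \<tau> * (if i = j then 1 else 0))) (at_right 0)"
    unfolding shifted_poly_def by (intro tendsto_intros lim_v)
  have "(\<lambda>i. x i + \<tau> * (if i = j then 1 else 0)) = x(j := t)" by (auto simp: \<tau>_def)
  note lim1 = lim1[unfolded this]
  have "(G \<longlongrightarrow> (\<Sum>T\<in>Pow U. w T * (\<Sum>i\<in>I. (\<Prod>k\<in>I-{i}. poly (L T k) (x k)) * (poly (pderiv (L T i)) (x i) * (if i = j then 1 else 0))))) (at_right 0)"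
    unfolding G_def by (intro tendsto_intros lim_v)
  also have "(\<Sum>T\<in>Pow U. w T * (\<Sum>i\<in>I. (\<Prod>k\<in>I-{i}. poly (L T k) (x k)) * (poly (pderiv (L T i)) (x i) * (if i = j then 1 else 0))))
     = poly (pderiv (coord_poly \<epsilon> \<alpha> j x)) (x j)"
    using finI j by (simp add: coord_poly_def L_def pderiv_sum_poly poly_sum pderiv_smult if_distrib[of "\<lambda>a. _ * a"] mult.assoc cong: if_cong)
  finally have lim2: "((\<lambda>\<eta>. shifted_poly \<epsilon> \<alpha> x * exp (\<tau> * (G \<eta> / shifted_poly \<epsilon> \<alpha> x))) \<longlongrightarrow>
      shifted_poly \<epsilon> \<alpha> x * exp (\<tau> * (poly (pderiv (coord_poly \<epsilon> \<alpha> j x)) (x j) / shifted_poly \<epsilon> \<alpha> x))) (at_right 0)"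
    using Hx by (intro tendsto_intros) auto
  have "\<forall>\<^sub>F \<eta> in at_right 0. \<forall>i\<in>I. \<eta> * \<bar>\<tau>\<bar> < x i"
  proof (intro eventually_ball_finite[OF finI] ballI)
    fix i assume "i \<in> I"
    have "((\<lambda>\<eta>. \<eta> * \<bar>\<tau>\<bar>) \<longlongrightarrow> 0 * \<bar>\<tau>\<bar>) (at_right 0)" by (intro tendsto_intros)
    then show "\<forall>\<^sub>F \<eta> in at_right 0. \<eta> * \<bar>\<tau>\<bar> < x i"
      by (rule order_tendstoD) (use x[OF \<open>i \<in> I\<close>] in simp)
  qed
  then have "\<forall>\<^sub>F \<eta> in at_right 0. shifted_poly \<epsilon> \<alpha> (\<lambda>i. x i + \<tau> * v \<eta> i) \<le> shifted_poly \<epsilon> \<alpha> x * exp (\<tau> * (G \<eta> / shifted_poly \<epsilon> \<alpha> x))"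
    using eventually_at_right_less[of 0] by eventually_elim (rule ineq)
  then show ?thesis unfolding \<tau>_def[symmetric]
    by (intro tendsto_le[OF _ lim2 lim1]) auto
qed

text \<open>The points \<open>x\<close> are free on the blocks \<open>J\<close> that are counted and equal to \<open>1\<close> on the others.\<close>
definition capacity_ge :: "nat set \<Rightarrow> real \<Rightarrow> real \<Rightarrow> (nat \<Rightarrow> nat) \<Rightarrow> (nat \<Rightarrow> nat) \<Rightarrow> bool" where
  "capacity_ge J \<epsilon> C \<alpha> \<beta> \<longleftrightarrow> (\<forall>x. (\<forall>i. x i > (0::real)) \<and> (\<forall>i. i \<notin> J \<longrightarrow> x i = 1) \<longrightarrow>
      C * (\<Prod>i\<in>J. x i ^ \<beta> i) \<le> shifted_poly \<epsilon> \<alpha> x)"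

text \<open>The infimum of \<open>e\<^sup>u / u\<^sup>k\<close> over \<open>u > 0\<close> is the inverse of this number. In particular its value at \<open>0\<close> is \<open>1\<close>.\<close>
definition power_exp :: "nat \<Rightarrow> real" where "power_exp k = real k ^ k * exp (- real k)"

lemma power_exp_pos: "power_exp k > 0" by (cases "k = 0") (auto simp: power_exp_def)

text \<open>Compare \<open>C t\<^sup>k\<^sup>+\<^sup>1\<close> with the tangent bound at \<open>s\<close>, whose logarithmic slope is \<open>lam\<close>, at the point \<open>t = (k + 1) / lam\<close>, where
  the comparison is sharpest. The factor \<open>e\<^sup>u\<close> with \<open>u = s lam\<close> that remains is estimated from below by a multiple of
  \<open>u\<^sup>k\<close>.\<close>
lemma capacity_ge_step:
  assumes \<epsilon>: "\<epsilon> > 0" and J: "J \<subseteq> I" and j: "j \<in> J" and C: "C \<ge> 0" and k: "\<beta> j = Suc k"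
    and cap: "capacity_ge J \<epsilon> C \<alpha> \<beta>"
  shows "capacity_ge J \<epsilon> (C * power_exp (Suc k) / power_exp k) (\<alpha>(j := Suc (\<alpha> j))) (\<beta>(j := k))"
  unfolding capacity_ge_def
proof (intro allI impI)
  fix x :: "nat \<Rightarrow> real" assume x: "(\<forall>i. x i > 0) \<and> (\<forall>i. i \<notin> J \<longrightarrow> x i = 1)"
  have finJ: "finite J" using J finI finite_subset by blast
  have jI: "j \<in> I" using j J by auto
  define s where "s = x j"
  define h where "h = shifted_poly \<epsilon> \<alpha> x"
  define \<delta> where "\<delta> = poly (pderiv (coord_poly \<epsilon> \<alpha> j x)) s"
  define R where "R = (\<Prod>i\<in>J-{j}. x i ^ \<beta> i)"
  have s: "s > 0" and h: "h > 0" and R: "R > 0" using x shifted_poly_pos[OF \<epsilon>, of x] by (auto simp: s_def h_def R_def intro!: prod_pos)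
  have \<delta>: "\<delta> \<ge> 0" unfolding \<delta>_def s_def by (rule coord_poly_deriv_nonneg[OF \<epsilon> _ jI]) (use x in auto)
  have prodJ: "(\<Prod>i\<in>J. y i) = (\<Prod>i\<in>J-{j}. y i) * y j" for y :: "nat \<Rightarrow> real"
    using prod.remove[OF finJ j, of y] by (simp add: mult.commute)
  have tangent: "C * (R * t ^ Suc k) \<le> h * exp ((t - s) * (\<delta> / h))" if t: "t > 0" for t
  proof -
    have "C * (\<Prod>i\<in>J. (x(j := t)) i ^ \<beta> i) \<le> shifted_poly \<epsilon> \<alpha> (x(j := t))"
    proof -
      have "(\<forall>i. (x(j := t)) i > 0) \<and> (\<forall>i. i \<notin> J \<longrightarrow> (x(j := t)) i = 1)" using x t j by auto
      then show ?thesis using cap unfolding capacity_ge_def by blast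
    qed
    also have "\<dots> \<le> h * exp ((t - s) * (\<delta> / h))"
      unfolding h_def \<delta>_def s_def by (rule shifted_poly_tangent[OF \<epsilon> _ jI t]) (use x in auto)
    also have "(\<Prod>i\<in>J. (x(j := t)) i ^ \<beta> i) = R * t ^ Suc k"
      unfolding prodJ R_def k by (intro arg_cong2[of _ _ _ _ "(*)"] prod.cong) (auto simp: k)
    finally show ?thesis .
  qed
  have "C * power_exp (Suc k) / power_exp k * (R * s ^ k) \<le> \<delta>"
  proof (cases "\<delta> = 0")
    case True
    have "C = 0"
    proof (rule ccontr)
      assume "C \<noteq> 0"
      then have CR: "C * R > 0" using C R by simp
      \<comment> \<open>a vanishing derivative bounds \<open>h\<close>, while the left-hand side grows without bound unless \<open>C = 0\<close>\<close>
      define t where "t = max 1 (2 * h / (C * R))"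
      have "t \<ge> 1" "C * R * t \<ge> 2 * h" using CR by (auto simp: t_def max_def field_simps)
      have "t \<le> t ^ Suc k" using \<open>t \<ge> 1\<close> by (simp add: self_le_power)
      then have "C * R * t \<le> C * R * t ^ Suc k" using CR by (simp add: mult_left_mono)
      also have "\<dots> \<le> h" using tangent[of t] \<open>t \<ge> 1\<close> True by (simp add: mult.assoc)
      finally show False using \<open>C * R * t \<ge> 2 * h\<close> h by simp
    qed
    then show ?thesis using True by simp
  next
    case False
    define lam where "lam = \<delta> / h"
    have lam: "lam > 0" using False \<delta> h by (simp add: lam_def)
    define E where "E = exp (s * lam)"
    have E: "E > 0" by (simp add: E_def)
    have "(s * lam) ^ k \<le> power_exp k * E"
      unfolding power_exp_def E_def using s lam by (intro power_le_scaled_exp) simp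
    then have sk: "s ^ k / power_exp k \<le> E / lam ^ k"
      using power_exp_pos[of k] lam by (simp add: field_simps power_mult_distrib)
    have "C * (R * (real (Suc k) / lam) ^ Suc k) \<le> h * exp ((real (Suc k) / lam - s) * lam)"
      unfolding lam_def by (rule tangent) (use False \<delta> h in simp)
    also have "(real (Suc k) / lam - s) * lam = real (Suc k) - s * lam" using lam by (simp add: field_simps)
    finally have "C * (R * (real (Suc k) / lam) ^ Suc k) \<le> h * (exp (real (Suc k)) / E)"
      by (simp add: exp_diff E_def)
    then have "C * (R * (real (Suc k) / lam) ^ Suc k) * (E * exp (- real (Suc k)) * lam)
       \<le> h * (exp (real (Suc k)) / E) * (E * exp (- real (Suc k)) * lam)"
      using E lam by (intro mult_right_mono) auto
    also have "\<dots> = h * lam" using E by (simp add: exp_minus del: of_nat_Suc)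
    also have "\<dots> = \<delta>" using h by (simp add: lam_def)
    also have "C * (R * (real (Suc k) / lam) ^ Suc k) * (E * exp (- real (Suc k)) * lam)
       = C * R * power_exp (Suc k) * (E / lam ^ k)"
      using lam by (simp add: power_exp_def power_divide del: of_nat_Suc)
    finally have "C * R * power_exp (Suc k) * (E / lam ^ k) \<le> \<delta>" .
    moreover have "C * R * power_exp (Suc k) * (s ^ k / power_exp k) \<le> C * R * power_exp (Suc k) * (E / lam ^ k)"
      using sk C R power_exp_pos[of "Suc k"] by (intro mult_left_mono) auto
    ultimately show ?thesis by (simp add: mult_ac)
  qed
  moreover have "(\<Prod>i\<in>J. x i ^ (\<beta>(j := k)) i) = R * s ^ k"
    unfolding prodJ R_def s_def by (intro arg_cong2[of _ _ _ _ "(*)"] prod.cong) auto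
  moreover have "shifted_poly \<epsilon> (\<alpha>(j := Suc (\<alpha> j))) x = \<epsilon> * h + \<delta>"
    using shifted_poly_Suc[OF jI, of \<epsilon> \<alpha> x s] poly_coord_poly[OF jI, of \<epsilon> \<alpha> x s] by (simp add: h_def \<delta>_def s_def)
  ultimately show "C * power_exp (Suc k) / power_exp k * (\<Prod>i\<in>J. x i ^ (\<beta>(j := k)) i) \<le> shifted_poly \<epsilon> (\<alpha>(j := Suc (\<alpha> j))) x"
    using \<epsilon> h by (simp add: add_increasing)
qed

lemma capacity_ge_iterate:
  assumes \<epsilon>: "\<epsilon> > 0" and J: "J \<subseteq> I" and C: "C \<ge> 0" and cap: "capacity_ge J \<epsilon> C (\<lambda>_. 0) \<kappa>"
    and "\<And>i. i \<in> J \<Longrightarrow> \<alpha> i \<le> \<kappa> i" "\<And>i. i \<notin> J \<Longrightarrow> \<alpha> i = 0"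
  shows "capacity_ge J \<epsilon> (C * (\<Prod>i\<in>J. power_exp (\<kappa> i) / power_exp (\<kappa> i - \<alpha> i))) \<alpha> (\<lambda>i. \<kappa> i - \<alpha> i)"
  using assms(5,6)
proof (induction "\<Sum>i\<in>J. \<alpha> i" arbitrary: \<alpha>)
  case 0
  have "finite J" using J finI finite_subset by blast
  then have "\<alpha> = (\<lambda>_. 0)" using 0 by (metis sum_eq_0_iff ext)
  then show ?case using cap power_exp_pos by (simp add: less_imp_neq[THEN not_sym])
next
  case (Suc s)
  have finJ: "finite J" using J finI finite_subset by blast
  obtain j where j: "j \<in> J" "\<alpha> j \<noteq> 0" using Suc.hyps(2) by (metis sum.neutral nat.simps(3))
  define \<beta> where "\<beta> = \<alpha>(j := \<alpha> j - 1)"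
  have \<alpha>: "\<alpha> = \<beta>(j := Suc (\<beta> j))" using j by (auto simp: \<beta>_def)
  have \<beta>j: "\<alpha> j = Suc (\<beta> j)" using j by (simp add: \<beta>_def)
  define k where "k = \<kappa> j - \<alpha> j"
  have k: "\<kappa> j - \<beta> j = Suc k" using Suc.prems(1)[OF j(1)] \<beta>j by (simp add: k_def)
  have sm: "(\<Sum>i\<in>J. f i) = f j + (\<Sum>i\<in>J-{j}. f i)" for f :: "nat \<Rightarrow> nat"
    by (rule sum.remove[OF finJ j(1)])
  have "(\<Sum>i\<in>J-{j}. \<alpha> i) = (\<Sum>i\<in>J-{j}. \<beta> i)" by (intro sum.cong) (auto simp: \<beta>_def)
  then have "s = (\<Sum>i\<in>J. \<beta> i)" using Suc.hyps(2) sm[of \<alpha>] sm[of \<beta>] \<beta>j by simp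
  moreover have "\<beta> i \<le> \<kappa> i" if "i \<in> J" for i
    using Suc.prems(1)[OF that] by (auto simp: \<beta>_def)
  moreover have "\<beta> i = 0" if "i \<notin> J" for i
    using Suc.prems(2)[OF that] j that by (auto simp: \<beta>_def)
  ultimately have IH: "capacity_ge J \<epsilon> (C * (\<Prod>i\<in>J. power_exp (\<kappa> i) / power_exp (\<kappa> i - \<beta> i))) \<beta> (\<lambda>i. \<kappa> i - \<beta> i)"
    by (rule Suc.hyps(1))
  have "C * (\<Prod>i\<in>J. power_exp (\<kappa> i) / power_exp (\<kappa> i - \<beta> i)) \<ge> 0"
    using C power_exp_pos by (intro mult_nonneg_nonneg prod_nonneg) (auto simp: less_imp_le)
  from capacity_ge_step[OF \<epsilon> J j(1) this k IH]
  have "capacity_ge J \<epsilon> (C * (\<Prod>i\<in>J. power_exp (\<kappa> i) / power_exp (\<kappa> i - \<beta> i)) * power_exp (Suc k) / power_exp k) \<alpha> ((\<lambda>i. \<kappa> i - \<beta> i)(j := k))"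
    using \<alpha> by simp
  moreover have "(\<lambda>i. \<kappa> i - \<beta> i)(j := k) = (\<lambda>i. \<kappa> i - \<alpha> i)" by (auto simp: \<beta>_def k_def)
  moreover have "(\<Prod>i\<in>J. power_exp (\<kappa> i) / power_exp (\<kappa> i - \<beta> i)) * power_exp (Suc k) / power_exp k = (\<Prod>i\<in>J. power_exp (\<kappa> i) / power_exp (\<kappa> i - \<alpha> i))"
  proof -
    have pm: "(\<Prod>i\<in>J. f i) = f j * (\<Prod>i\<in>J-{j}. f i)" for f :: "nat \<Rightarrow> real"
      by (rule prod.remove[OF finJ j(1)])
    have "(\<Prod>i\<in>J-{j}. power_exp (\<kappa> i) / power_exp (\<kappa> i - \<beta> i)) = (\<Prod>i\<in>J-{j}. power_exp (\<kappa> i) / power_exp (\<kappa> i - \<alpha> i))"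
      by (intro prod.cong) (auto simp: \<beta>_def)
    moreover have "power_exp (\<kappa> j) / power_exp (\<kappa> j - \<beta> j) * power_exp (Suc k) / power_exp k = power_exp (\<kappa> j) / power_exp (\<kappa> j - \<alpha> j)"
      unfolding k using power_exp_pos[of "Suc k"] by (simp add: k_def)
    ultimately show ?thesis unfolding pm by (metis (no_types, lifting) mult.assoc mult.commute times_divide_eq_right)
  qed
  ultimately show ?case by (metis (no_types, lifting) mult.assoc times_divide_eq_right)
qed

text \<open>After all derivatives are taken, the lower bound is constant in \<open>x\<close>. At \<open>x = \<epsilon>\<close>, in the limit
  \<open>\<epsilon> \<rightarrow> 0\<close>, only the sets with the prescribed counts survive, each with the factor \<open>\<Prod> \<kappa>\<^sub>i!\<close>.\<close>
lemma coefficient_ge_capacity: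
  assumes J: "J \<subseteq> I" and C: "C \<ge> 0"
    and cap: "\<And>x. (\<And>i. x i > 0) \<Longrightarrow> (\<And>i. i \<notin> J \<Longrightarrow> x i = 1) \<Longrightarrow>
       C * (\<Prod>i\<in>J. x i ^ \<kappa> i) \<le> weight_poly U w (\<lambda>e. x (blk e))"
  shows "C * (\<Prod>i\<in>J. real (\<kappa> i) ^ \<kappa> i * exp (- real (\<kappa> i)) / fact (\<kappa> i))
      \<le> (\<Sum>T | T \<subseteq> U \<and> (\<forall>i\<in>J. block_count T i = \<kappa> i). w T)"
proof -
  have finJ: "finite J" using J finI finite_subset by blast
  define \<alpha> where "\<alpha> = (\<lambda>i. if i \<in> J then \<kappa> i else 0)"
  define y where "y = (\<lambda>(\<epsilon>::real) i. if i \<in> J then \<epsilon> else 1)"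
  define N where "N = (\<Prod>i\<in>J. power_exp (\<kappa> i))"
  define F where "F = (\<Prod>i\<in>J. fact (\<kappa> i) :: real)"
  have lower: "C * N \<le> shifted_poly \<epsilon> \<alpha> (y \<epsilon>)" if \<epsilon>: "\<epsilon> > 0" for \<epsilon>
  proof -
    have "capacity_ge J \<epsilon> C (\<lambda>_. 0) \<kappa>"
      unfolding capacity_ge_def shifted_poly_0 using cap by blast
    from capacity_ge_iterate[OF \<epsilon> J C this, of \<alpha>]
    have cb: "capacity_ge J \<epsilon> (C * (\<Prod>i\<in>J. power_exp (\<kappa> i) / power_exp (\<kappa> i - \<alpha> i))) \<alpha> (\<lambda>i. \<kappa> i - \<alpha> i)"
      by (simp add: \<alpha>_def)
    have "(\<Prod>i\<in>J. power_exp (\<kappa> i) / power_exp (\<kappa> i - \<alpha> i)) = N"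
      unfolding N_def by (intro prod.cong) (auto simp: \<alpha>_def power_exp_def)
    moreover have "(\<Prod>i\<in>J. y \<epsilon> i ^ (\<kappa> i - \<alpha> i)) = 1"
      by (intro prod.neutral) (auto simp: \<alpha>_def)
    moreover have "C * (\<Prod>i\<in>J. power_exp (\<kappa> i) / power_exp (\<kappa> i - \<alpha> i)) * (\<Prod>i\<in>J. y \<epsilon> i ^ (\<kappa> i - \<alpha> i)) \<le> shifted_poly \<epsilon> \<alpha> (y \<epsilon>)"
      by (rule cb[unfolded capacity_ge_def, rule_format]) (use \<epsilon> in \<open>auto simp: y_def\<close>)
    ultimately show ?thesis by simp
  qed
  define lim where "lim = (\<lambda>T i. if i \<in> J then (if block_count T i = \<kappa> i then fact (\<kappa> i) else 0) else 1 :: real)"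
  have lim_i: "((\<lambda>\<epsilon>. poly (diff_pow \<epsilon> (\<alpha> i) (block_count T i)) (y \<epsilon> i)) \<longlongrightarrow> lim T i) (at_right 0)" for T i
  proof (cases "i \<in> J")
    case True
    then show ?thesis using diff_pow_limit[of "\<kappa> i" "block_count T i"] by (simp add: \<alpha>_def y_def lim_def)
  qed (simp add: \<alpha>_def y_def lim_def poly_monom)
  have "((\<lambda>\<epsilon>. shifted_poly \<epsilon> \<alpha> (y \<epsilon>)) \<longlongrightarrow> (\<Sum>T\<in>Pow U. of_real (w T) * (\<Prod>i\<in>I. lim T i))) (at_right 0)"
    unfolding shifted_poly_def by (intro tendsto_intros lim_i)
  then have "C * N \<le> (\<Sum>T\<in>Pow U. of_real (w T) * (\<Prod>i\<in>I. lim T i))"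
    by (rule tendsto_lowerbound) (use lower in \<open>auto simp: eventually_at_filter\<close>)
  also have "\<dots> = (\<Sum>T\<in>Pow U. if \<forall>i\<in>J. block_count T i = \<kappa> i then F * w T else 0)"
  proof (intro sum.cong refl)
    fix T
    have "(\<Prod>i\<in>I. lim T i) = (\<Prod>i\<in>J. lim T i)"
      using J finI by (intro prod.mono_neutral_right) (auto simp: lim_def)
    also have "\<dots> = (if \<forall>i\<in>J. block_count T i = \<kappa> i then F else 0)"
      using finJ by (auto simp: lim_def F_def intro!: prod.cong prod_zero)
    finally show "of_real (w T) * (\<Prod>i\<in>I. lim T i) = (if \<forall>i\<in>J. block_count T i = \<kappa> i then F * w T else 0)" by simp
  qed
  also have "\<dots> = F * (\<Sum>T | T \<subseteq> U \<and> (\<forall>i\<in>J. block_count T i = \<kappa> i). w T)"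
    using fin by (subst sum.inter_filter[symmetric]) (simp_all add: sum_distrib_left)
  finally have "C * N \<le> F * (\<Sum>T | T \<subseteq> U \<and> (\<forall>i\<in>J. block_count T i = \<kappa> i). w T)" .
  moreover have "F > 0" by (simp add: F_def prod_pos)
  moreover have eq: "(\<Prod>i\<in>J. real (\<kappa> i) ^ \<kappa> i * exp (- real (\<kappa> i)) / fact (\<kappa> i)) = N / F"
    by (simp add: N_def F_def power_exp_def prod_dividef)
  ultimately show ?thesis unfolding eq by (simp add: pos_divide_le_eq mult.commute)
qed

end

section \<open>A lower bound for the capacity\<close>

text \<open>The combinatorics of moving all values below \<open>1\<close> up to \<open>1\<close>. The set \<open>S\<close> of indices at the current minimum
  grows by one index per step, so the factors \<open>\<phi> k\<close> are used once each, and the powers \<open>(c / c') powr \<kappa>\<close> telescope.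
  The function \<open>P\<close> and the real exponents are abstract because the lemma is used a second time for \<open>P (1 / x)\<close> and
  \<open>-\<kappa>\<close>.\<close>
lemma chain_peel:
  fixes P :: "(nat \<Rightarrow> real) \<Rightarrow> real" and \<kappa> \<phi> :: "nat \<Rightarrow> real" and x :: "nat \<Rightarrow> real"
  assumes fin: "finite I" and \<phi>: "\<And>k. 0 \<le> \<phi> k"
    and peel: "\<And>S c c' x. S \<subseteq> I \<Longrightarrow> 0 < c \<Longrightarrow> c \<le> c' \<Longrightarrow> c' \<le> 1 \<Longrightarrow> (\<And>i. 0 < x i) \<Longrightarrow>
        (\<And>i. i \<in> S \<Longrightarrow> x i = c) \<Longrightarrow> (\<And>i. i \<in> I - S \<Longrightarrow> c' \<le> x i) \<Longrightarrow>
        \<phi> (card S) * (c / c') powr (\<Sum>i\<in>S. \<kappa> i) * P (\<lambda>i. if i \<in> S then c' else x i) \<le> P x"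
    and x: "\<And>i. 0 < x i"
  shows "(\<Prod>k\<in>{1..card {i\<in>I. x i < 1}}. \<phi> k) * (\<Prod>i\<in>{i\<in>I. x i < 1}. x i powr \<kappa> i)
      * P (\<lambda>i. if i \<in> I \<and> x i < 1 then 1 else x i) \<le> P x"
proof -
  define W where "W = (\<lambda>x::nat\<Rightarrow>real. {i\<in>I. x i < 1})"
  define top where "top = (\<lambda>(x::nat\<Rightarrow>real) i. if i \<in> I \<and> x i < 1 then 1 else x i)"
  have finW: "finite (W x)" for x using fin by (simp add: W_def)
  have claim: "(\<Prod>k\<in>{card S..card (W x)}. \<phi> k) * (\<Prod>i\<in>W x. x i powr \<kappa> i) * P (top x) \<le> P x"
    if "S \<subseteq> W x" "card (W x - S) = N" "0 < c" "c < 1" "\<And>i. 0 < x i" "\<And>i. i \<in> S \<Longrightarrow> x i = c"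
      "\<And>i. i \<in> I \<Longrightarrow> c \<le> x i" for S N x c
    using that
  proof (induction N arbitrary: S x c)
    case 0
    then have S: "S = W x" using finW[of x] by auto
    have SI: "S \<subseteq> I" by (auto simp: S W_def)
    have "\<phi> (card S) * (c / 1) powr (\<Sum>i\<in>S. \<kappa> i) * P (\<lambda>i. if i \<in> S then 1 else x i) \<le> P x"
    proof (rule peel)
      show "1 \<le> x i" if "i \<in> I - S" for i using that by (auto simp: S W_def)
    qed (use 0(3-6) SI in auto)
    moreover have "(\<lambda>i. if i \<in> S then 1 else x i) = top x" by (auto simp: S W_def top_def)
    moreover have "(\<Prod>i\<in>W x. x i powr \<kappa> i) = c powr (\<Sum>i\<in>S. \<kappa> i)"
      using 0 finW[of x] unfolding S by (subst powr_sum) auto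
    ultimately show ?case by (simp add: S)
  next
    case (Suc N)
    define R where "R = W x - S"
    have "card R = Suc N" using Suc.prems(2) by (simp add: R_def)
    then have "R \<noteq> {}" by auto
    moreover have "finite R" using finW[of x] by (simp add: R_def)
    ultimately have R: "finite R" "R \<noteq> {}" by simp_all
    define c' where "c' = Min (x ` R)"
    have "Min (x ` R) \<in> x ` R" using R by (intro Min_in) auto
    then obtain j where j: "j \<in> R" "x j = c'"
      unfolding c'_def by (metis imageE)
    have min: "c' \<le> x i" if "i \<in> R" for i unfolding c'_def using that R by auto
    have c': "c \<le> c'" "c' < 1" "0 < c'"
      using Suc.prems(5,7)[of j] j by (auto simp: R_def W_def)
    define x' where "x' = (\<lambda>i. if i \<in> S then c' else x i)"
    have off: "c' \<le> x i" if "i \<in> I - S" for i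
      using that min[of i] c' by (cases "x i < 1") (auto simp: R_def W_def)
    have SI: "S \<subseteq> I" "finite S" using Suc.prems(1) finW[of x] by (auto simp: W_def intro: finite_subset)
    have Wx': "W x' = W x" using Suc.prems(1) c' by (auto simp: W_def x'_def)
    have "top x' = top x"
      by (rule ext) (use Suc.prems(1) c' in \<open>auto simp: W_def x'_def top_def\<close>)
    have step: "\<phi> (card S) * (c / c') powr (\<Sum>i\<in>S. \<kappa> i) * P x' \<le> P x"
      unfolding x'_def by (rule peel) (use Suc.prems(3-6) SI c' off in auto)
    have jS: "j \<notin> S" "insert j S \<subseteq> W x" using j Suc.prems(1) by (auto simp: R_def)
    have "(\<Prod>k\<in>{card (insert j S)..card (W x')}. \<phi> k) * (\<Prod>i\<in>W x'. x' i powr \<kappa> i) * P (top x') \<le> P x'"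
    proof (rule Suc.IH[of _ _ c'])
      have "W x - insert j S = R - {j}" by (auto simp: R_def)
      then show "card (W x' - insert j S) = N" using Suc.prems(2) R j(1) by (simp add: Wx' R_def)
    qed (use c' jS Wx' j off Suc.prems(5) in \<open>auto simp: x'_def\<close>)
    then have IH: "(\<Prod>k\<in>{Suc (card S)..card (W x)}. \<phi> k) * (\<Prod>i\<in>W x. x' i powr \<kappa> i) * P (top x) \<le> P x'"
      using jS SI by (simp add: Wx' \<open>top x' = top x\<close>)
    have W: "W x = S \<union> R" "S \<inter> R = {}" using Suc.prems(1) by (auto simp: R_def)
    have spl: "(\<Prod>i\<in>W x. h i) = (\<Prod>i\<in>S. h i) * (\<Prod>i\<in>R. h i)" for h :: "nat \<Rightarrow> real"
      unfolding W(1) by (rule prod.union_disjoint[OF SI(2) R(1) W(2)])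
    have "(c / c') powr (\<Sum>i\<in>S. \<kappa> i) * (\<Prod>i\<in>W x. x' i powr \<kappa> i)
        = ((c / c') powr (\<Sum>i\<in>S. \<kappa> i) * c' powr (\<Sum>i\<in>S. \<kappa> i)) * (\<Prod>i\<in>R. x i powr \<kappa> i)"
    proof -
      have "(\<Prod>i\<in>S. x' i powr \<kappa> i) = c' powr (\<Sum>i\<in>S. \<kappa> i)"
        using c' SI by (subst powr_sum) (auto simp: x'_def)
      moreover have "(\<Prod>i\<in>R. x' i powr \<kappa> i) = (\<Prod>i\<in>R. x i powr \<kappa> i)"
        by (rule prod.cong) (auto simp: x'_def R_def)
      ultimately show ?thesis by (simp add: spl)
    qed
    also have "(c / c') powr (\<Sum>i\<in>S. \<kappa> i) * c' powr (\<Sum>i\<in>S. \<kappa> i) = (\<Prod>i\<in>S. x i powr \<kappa> i)"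
      using c' SI Suc.prems(3,6) by (simp add: powr_divide powr_sum)
    also have "\<dots> * (\<Prod>i\<in>R. x i powr \<kappa> i) = (\<Prod>i\<in>W x. x i powr \<kappa> i)" by (simp add: spl)
    finally have power_exp: "(c / c') powr (\<Sum>i\<in>S. \<kappa> i) * (\<Prod>i\<in>W x. x' i powr \<kappa> i) = (\<Prod>i\<in>W x. x i powr \<kappa> i)" .
    have "card S \<le> card (W x)" by (rule card_mono[OF finW Suc.prems(1)])
    then have "(\<Prod>k\<in>{card S..card (W x)}. \<phi> k) = \<phi> (card S) * (\<Prod>k\<in>{Suc (card S)..card (W x)}. \<phi> k)"
      by (rule prod.atLeast_Suc_atMost)
    then have "(\<Prod>k\<in>{card S..card (W x)}. \<phi> k) * (\<Prod>i\<in>W x. x i powr \<kappa> i) * P (top x)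
      = \<phi> (card S) * (c / c') powr (\<Sum>i\<in>S. \<kappa> i) *
        ((\<Prod>k\<in>{Suc (card S)..card (W x)}. \<phi> k) * (\<Prod>i\<in>W x. x' i powr \<kappa> i) * P (top x))"
      by (simp add: power_exp[symmetric] mult_ac)
    also have "\<dots> \<le> \<phi> (card S) * (c / c') powr (\<Sum>i\<in>S. \<kappa> i) * P x'"
      using \<phi> by (intro mult_left_mono IH) auto
    also note step
    finally show ?case .
  qed
  show ?thesis
  proof (cases "W x = {}")
    case True
    then have "top x = x" by (intro ext) (auto simp: W_def top_def)
    have "(\<Prod>k\<in>{1..card (W x)}. \<phi> k) * (\<Prod>i\<in>W x. x i powr \<kappa> i) * P (top x) \<le> P x"
      unfolding \<open>top x = x\<close> True by simp
    then show ?thesis unfolding W_def top_def .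
  next
    case False
    define c where "c = Min (x ` W x)"
    have "Min (x ` W x) \<in> x ` W x" using finW[of x] False by (intro Min_in) auto
    then obtain j where j: "j \<in> W x" "x j = c"
      unfolding c_def by (metis imageE)
    have "c \<le> x i" if "i \<in> I" for i
    proof (cases "i \<in> W x")
      case True then show ?thesis unfolding c_def using finW[of x] by auto
    next
      case False then show ?thesis using that j by (auto simp: W_def)
    qed
    then have "(\<Prod>k\<in>{card {j}..card (W x)}. \<phi> k) * (\<Prod>i\<in>W x. x i powr \<kappa> i) * P (top x) \<le> P x"
      using j x by (intro claim[of "{j}" x _ c]) (auto simp: W_def)
    then show ?thesis unfolding W_def top_def by simp
  qed
qed

text \<open>By convexity, the chord of \<open>N \<mapsto> r\<^sup>N\<close> through \<open>K\<close> and \<open>K + 1\<close> lies below the function at all integers.\<close>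
lemma power_ge_upper_chord:
  fixes r :: real
  assumes r: "r > 0"
  shows "r ^ K * (1 - (1 - r) * (real N - real K)) \<le> r ^ N"
proof (cases "K \<le> N")
  case True
  then obtain m where N: "N = K + m" by (metis le_add_diff_inverse)
  have "1 - (1 - r) * real m \<le> r ^ m"
    using Bernoulli_inequality[of "r - 1" m] r by (simp add: algebra_simps)
  then show ?thesis using r by (simp add: N power_add)
next
  case False
  then obtain m where K: "K = N + m" by (metis le_add_diff_inverse nat_le_linear)
  have "1 - r \<le> 1 / r - 1"
    using r sum_squares_ge_zero[of "r - 1" 0] by (simp add: field_simps)
  then have "1 + real m * (1 - r) \<le> 1 + real m * (1 / r - 1)"
    by (simp add: mult_left_mono)
  also have "\<dots> \<le> (1 / r) ^ m" using Bernoulli_inequality[of "1 / r - 1" m] r by simp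
  finally have "r ^ m * (1 + real m * (1 - r)) \<le> 1" using r by (simp add: power_divide field_simps)
  then have "r ^ N * (r ^ m * (1 + real m * (1 - r))) \<le> r ^ N * 1"
    using r by (intro mult_left_mono) auto
  then show ?thesis by (simp add: K power_add algebra_simps)
qed

text \<open>The same for the chord through \<open>K - 1\<close> and \<open>K\<close>.\<close>
lemma power_ge_lower_chord:
  fixes r :: real
  assumes r: "r > 0"
  shows "r ^ K * (1 + (1 - 1 / r) * (real N - real K)) \<le> r ^ N"
proof -
  have "(1 / r) ^ N * (1 - (1 - 1 / r) * (real K - real N)) \<le> (1 / r) ^ K"
    by (rule power_ge_upper_chord) (use r in simp)
  then show ?thesis using r by (simp add: power_divide field_simps)
qed

context block_weight
begin

definition block_poly :: "nat set \<Rightarrow> (nat \<Rightarrow> real) \<Rightarrow> real" where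
  "block_poly J x = weight_poly U w (\<lambda>e. if blk e \<in> J then x (blk e) else 1)"

lemma block_poly_cong: "(\<And>i. i \<in> J \<Longrightarrow> x i = y i) \<Longrightarrow> block_poly J x = block_poly J y"
  unfolding block_poly_def by (rule weight_poly_cong) auto

lemma block_poly_nonneg: "(\<And>i. x i > 0) \<Longrightarrow> block_poly J x \<ge> 0"
  unfolding block_poly_def by (rule weight_poly_nonneg) (auto simp: nonneg less_imp_le)

lemma card_blocks:
  assumes "T \<subseteq> U" "finite S"
  shows "card {e\<in>T. blk e \<in> S} = (\<Sum>i\<in>S. block_count T i)"
proof -
  have T: "finite T" using assms fin finite_subset by auto
  have "{e\<in>T. blk e \<in> S} = (\<Union>i\<in>S. {e\<in>T. blk e = i})" by auto
  then show ?thesis unfolding block_count_def using T assms by (simp add: card_UN_disjoint disjoint_iff)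
qed

text \<open>A form of \<open>weight_poly_peel\<close> in which the sum is the expectation of \<open>r\<close> to the power of the number of
  elements in the blocks \<open>S\<close>.\<close>
lemma block_peel:
  assumes S: "S \<subseteq> J" "finite S" and x: "\<And>i. x i > 0" and c: "c > 0" and r: "r > 0"
    and side: "(r \<le> 1 \<and> c \<le> 1 \<and> (\<forall>i\<in>J-S. c \<le> x i)) \<or> (1 \<le> r \<and> 1 \<le> c \<and> (\<forall>i\<in>J-S. x i \<le> c))"
    and total: "(\<Sum>T\<in>Pow U. w T) = 1"
  shows "block_poly J (\<lambda>i. if i \<in> S then c else x i) * (\<Sum>T\<in>Pow U. w T * r ^ (\<Sum>i\<in>S. block_count T i))
    \<le> block_poly J (\<lambda>i. if i \<in> S then r * c else x i)"
proof -
  define Q where "Q = {e\<in>U. blk e \<in> S}"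
  define y where "y = (\<lambda>e. if blk e \<in> J then (if blk e \<in> S then c else x (blk e)) else 1)"
  let ?tilt = "\<lambda>z f. if f \<in> Q then r * z f else z f"
  have "weight_poly U w y * weight_poly U w (?tilt (\<lambda>_. 1)) \<le> weight_poly U w (?tilt y) * weight_poly U w (\<lambda>_. 1)"
    by (rule weight_poly_peel[where c = c])
      (use S x c r side in \<open>auto simp: Q_def y_def\<close>)
  moreover have "weight_poly U w (\<lambda>_. 1) = (1::real)" using total by (simp add: weight_poly_def)
  moreover have "weight_poly U w (?tilt y) = block_poly J (\<lambda>i. if i \<in> S then r * c else x i)"
    unfolding block_poly_def by (rule weight_poly_cong) (use S in \<open>auto simp: Q_def y_def\<close>)
  moreover have "weight_poly U w y = block_poly J (\<lambda>i. if i \<in> S then c else x i)"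
    unfolding block_poly_def y_def ..
  moreover have "weight_poly U w (?tilt (\<lambda>_. 1)) = (\<Sum>T\<in>Pow U. w T * r ^ (\<Sum>i\<in>S. block_count T i))"
    unfolding weight_poly_def
  proof (intro sum.cong refl)
    fix T assume T: "T \<in> Pow U"
    then have "finite T" using fin finite_subset by auto
    then have "(\<Prod>e\<in>T. ?tilt (\<lambda>_. 1) e) = (\<Prod>e\<in>{e\<in>T. blk e \<in> S}. r)"
      using T by (subst prod.inter_filter) (auto simp: Q_def intro!: prod.cong)
    also have "\<dots> = r ^ (\<Sum>i\<in>S. block_count T i)" using T S by (simp add: card_blocks)
    finally show "of_real (w T) * (\<Prod>e\<in>T. ?tilt (\<lambda>_. 1) e) = w T * r ^ (\<Sum>i\<in>S. block_count T i)" by simp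
  qed
  ultimately show ?thesis by simp
qed

lemma weighted_chord:
  assumes "finite S" and total: "(\<Sum>T\<in>Pow U. w T) = 1"
    and chord: "\<And>N. r ^ K * (1 + a * (real N - real K)) \<le> r ^ N"
    and dev: "dev = (\<Sum>T\<in>Pow U. w T * real (\<Sum>i\<in>S. block_count T i)) - real K"
  shows "r ^ K * (1 + a * dev) \<le> (\<Sum>T\<in>Pow U. w T * r ^ (\<Sum>i\<in>S. block_count T i))"
proof -
  have "r ^ K * (1 + a * dev) = r ^ K * ((\<Sum>T\<in>Pow U. w T) * (1 - a * real K) + a * (\<Sum>T\<in>Pow U. w T * real (\<Sum>i\<in>S. block_count T i)))"
    unfolding total dev by (simp add: algebra_simps)
  also have "\<dots> = (\<Sum>T\<in>Pow U. w T * (r ^ K * (1 + a * (real (\<Sum>i\<in>S. block_count T i) - real K))))"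
    by (simp add: sum_distrib_left sum_distrib_right sum.distrib[symmetric] algebra_simps del: of_nat_sum)
  also have "\<dots> \<le> (\<Sum>T\<in>Pow U. w T * r ^ (\<Sum>i\<in>S. block_count T i))"
    by (intro sum_mono mult_left_mono chord nonneg)
  finally show ?thesis .
qed

end

text \<open>The numbers \<open>\<phi> k\<close> and \<open>\<psi> k\<close> stand for \<open>\<epsilon>\<^sub>k\<close> and \<open>\<delta>\<^sub>k\<close> truncated to the unit interval; \<open>sum d S\<close> is the deviation
  of \<open>S\<close>.\<close>
locale block_prob = block_weight +
  fixes J :: "nat set" and \<kappa> :: "nat \<Rightarrow> nat" and d :: "nat \<Rightarrow> real" and \<phi> \<psi> :: "nat \<Rightarrow> real"
  assumes J: "J \<subseteq> I" and total: "(\<Sum>T\<in>Pow U. w T) = 1"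
    and d: "\<And>i. i \<in> J \<Longrightarrow> d i = (\<Sum>T\<in>Pow U. w T * real (block_count T i)) - real (\<kappa> i)"
    and small: "\<And>S. S \<subseteq> J \<Longrightarrow> \<bar>sum d S\<bar> < 1"
    and \<phi>: "\<And>S. S \<subseteq> J \<Longrightarrow> \<phi> (card S) \<le> max 0 (min 1 (1 - sum d S))" "\<And>k. \<phi> k \<ge> 0"
    and \<psi>: "\<And>S. S \<subseteq> J \<Longrightarrow> \<psi> (card S) \<le> max 0 (min 1 (1 + sum d S))" "\<And>k. \<psi> k \<ge> 0"
begin

lemma finJ: "finite J" using J finI finite_subset by blast

lemma d_sum:
  assumes "S \<subseteq> J"
  shows "sum d S = (\<Sum>T\<in>Pow U. w T * real (\<Sum>i\<in>S. block_count T i)) - real (\<Sum>i\<in>S. \<kappa> i)"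
proof -
  have "sum d S = (\<Sum>i\<in>S. (\<Sum>T\<in>Pow U. w T * real (block_count T i)) - real (\<kappa> i))"
    using assms d by (intro sum.cong) auto
  also have "\<dots> = (\<Sum>T\<in>Pow U. \<Sum>i\<in>S. w T * real (block_count T i)) - (\<Sum>i\<in>S. real (\<kappa> i))"
    by (simp add: sum_subtractf sum.swap[of _ S])
  finally show ?thesis by (simp add: sum_distrib_left)
qed

lemma block_peel_down:
  assumes S: "S \<subseteq> J" and c: "0 < c" "c \<le> c'" "c' \<le> 1" and x: "\<And>i. 0 < x i"
    and xS: "\<And>i. i \<in> S \<Longrightarrow> x i = c" and xJ: "\<And>i. i \<in> J - S \<Longrightarrow> c' \<le> x i"
  shows "\<phi> (card S) * (c / c') powr (\<Sum>i\<in>S. real (\<kappa> i)) * block_poly J (\<lambda>i. if i \<in> S then c' else x i)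
    \<le> block_poly J x"
proof -
  define r where "r = c / c'"
  define K where "K = (\<Sum>i\<in>S. \<kappa> i)"
  have finS: "finite S" using S finJ finite_subset by blast
  have r: "0 < r" "r \<le> 1" using c by (auto simp: r_def)
  have "r ^ K * (1 + (- (1 - r)) * sum d S) \<le> (\<Sum>T\<in>Pow U. w T * r ^ (\<Sum>i\<in>S. block_count T i))"
  proof (rule weighted_chord[OF finS total])
    show "r ^ K * (1 + - (1 - r) * (real N - real K)) \<le> r ^ N" for N
      using power_ge_upper_chord[OF r(1), of K N] by (simp only: mult_minus_left add_uminus_conv_diff)
    show "sum d S = (\<Sum>T\<in>Pow U. w T * real (\<Sum>i\<in>S. block_count T i)) - real K"
      using d_sum[OF S] by (simp only: K_def)
  qed
  then have "r ^ K * (1 - (1 - r) * sum d S) \<le> (\<Sum>T\<in>Pow U. w T * r ^ (\<Sum>i\<in>S. block_count T i))"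
    by (simp only: mult_minus_left add_uminus_conv_diff)
  moreover have "\<phi> (card S) \<le> 1 - (1 - r) * sum d S"
  proof -
    have "max 0 (min 1 (1 - sum d S)) \<le> 1 - (1 - r) * sum d S"
    proof (cases "sum d S \<le> 0")
      case True
      then have "(1 - r) * sum d S \<le> 0" using r by (simp add: mult_nonneg_nonpos)
      then show ?thesis by simp
    next
      case False
      then have "(1 - r) * sum d S \<le> 1 * sum d S" using r by (intro mult_right_mono) auto
      then show ?thesis using small[OF S] by simp
    qed
    with \<phi>(1)[OF S] show ?thesis by (rule order_trans)
  qed
  then have "r ^ K * \<phi> (card S) \<le> r ^ K * (1 - (1 - r) * sum d S)"
    using r by (intro mult_left_mono) auto
  ultimately have E: "r ^ K * \<phi> (card S) \<le> (\<Sum>T\<in>Pow U. w T * r ^ (\<Sum>i\<in>S. block_count T i))"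
    by (rule order_trans[rotated])
  have nn: "block_poly J (\<lambda>i. if i \<in> S then c' else x i) \<ge> 0"
    by (rule block_poly_nonneg) (use c x in auto)
  have "r ^ K * \<phi> (card S) * block_poly J (\<lambda>i. if i \<in> S then c' else x i)
    \<le> (\<Sum>T\<in>Pow U. w T * r ^ (\<Sum>i\<in>S. block_count T i)) * block_poly J (\<lambda>i. if i \<in> S then c' else x i)"
    by (rule mult_right_mono[OF E nn])
  also have "\<dots> \<le> block_poly J (\<lambda>i. if i \<in> S then r * c' else x i)"
    unfolding mult.commute[of "sum _ _"]
    by (rule block_peel[OF S finS _ _ r(1) _ total]) (use x c r xJ in auto)
  also have "\<dots> = block_poly J x"
    by (rule block_poly_cong) (use c xS in \<open>auto simp: r_def\<close>)
  also have "r ^ K = (c / c') powr (\<Sum>i\<in>S. real (\<kappa> i))"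
    using r by (simp add: r_def K_def powr_realpow flip: of_nat_sum)
  finally show ?thesis by (simp add: mult_ac)
qed

text \<open>The mirror image of \<open>block_peel_down\<close>, written in the variables \<open>1 / x\<close> so that it has the form required
  by \<open>chain_peel\<close>. The ratio \<open>r = c' / c\<close> is now at least \<open>1\<close>, so the lower chord is the right one.\<close>
lemma block_peel_up:
  assumes S: "S \<subseteq> J" and c: "0 < c" "c \<le> c'" "c' \<le> 1" and x: "\<And>i. 0 < x i"
    and xS: "\<And>i. i \<in> S \<Longrightarrow> x i = c" and xJ: "\<And>i. i \<in> J - S \<Longrightarrow> c' \<le> x i"
  shows "\<psi> (card S) * (c / c') powr (\<Sum>i\<in>S. - real (\<kappa> i)) * block_poly J (\<lambda>i. 1 / (if i \<in> S then c' else x i))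
    \<le> block_poly J (\<lambda>i. 1 / x i)"
proof -
  define r where "r = c' / c"
  define K where "K = (\<Sum>i\<in>S. \<kappa> i)"
  have finS: "finite S" using S finJ finite_subset by blast
  have r: "0 < r" "r \<ge> 1" using c by (auto simp: r_def)
  have "r ^ K * (1 + (1 - 1 / r) * sum d S) \<le> (\<Sum>T\<in>Pow U. w T * r ^ (\<Sum>i\<in>S. block_count T i))"
    by (rule weighted_chord[OF finS total])
      (use power_ge_lower_chord[OF r(1), of K] d_sum[OF S] in \<open>auto simp: K_def\<close>)
  moreover have "\<psi> (card S) \<le> 1 + (1 - 1 / r) * sum d S"
  proof -
    define a where "a = 1 - 1 / r"
    have a: "0 \<le> a" "a \<le> 1" using r by (auto simp: a_def)
    have "max 0 (min 1 (1 + sum d S)) \<le> 1 + a * sum d S"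
    proof (cases "sum d S \<ge> 0")
      case True
      then have "a * sum d S \<ge> 0" using a by simp
      then show ?thesis by simp
    next
      case False
      then have "1 * sum d S \<le> a * sum d S" using a by (intro mult_right_mono_neg) auto
      then show ?thesis using small[OF S] by simp
    qed
    with \<psi>(1)[OF S] show ?thesis unfolding a_def by (rule order_trans)
  qed
  then have "r ^ K * \<psi> (card S) \<le> r ^ K * (1 + (1 - 1 / r) * sum d S)"
    using r by (intro mult_left_mono) auto
  ultimately have E: "r ^ K * \<psi> (card S) \<le> (\<Sum>T\<in>Pow U. w T * r ^ (\<Sum>i\<in>S. block_count T i))" by simp
  have nn: "block_poly J (\<lambda>i. if i \<in> S then 1 / c' else 1 / x i) \<ge> 0"
    by (rule block_poly_nonneg) (use c x in auto)
  have "r ^ K * \<psi> (card S) * block_poly J (\<lambda>i. if i \<in> S then 1 / c' else 1 / x i)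
    \<le> (\<Sum>T\<in>Pow U. w T * r ^ (\<Sum>i\<in>S. block_count T i)) * block_poly J (\<lambda>i. if i \<in> S then 1 / c' else 1 / x i)"
    by (rule mult_right_mono[OF E nn])
  also have "\<dots> \<le> block_poly J (\<lambda>i. if i \<in> S then r * (1 / c') else 1 / x i)"
  proof -
    have "(1 / c' :: real) > 0" "1 \<le> 1 / c'" "\<forall>i\<in>J-S. 1 / x i \<le> 1 / c'"
      using c xJ by (auto intro!: divide_left_mono simp: x)
    then show ?thesis
      using block_peel[OF S finS _ _ r(1) _ total, of "\<lambda>i. 1 / x i" "1 / c'"] r x by (simp add: mult.commute)
  qed
  also have "\<dots> = block_poly J (\<lambda>i. 1 / x i)"
    by (rule block_poly_cong) (use c xS in \<open>auto simp: r_def\<close>)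
  also have "r ^ K = (c / c') powr (\<Sum>i\<in>S. - real (\<kappa> i))"
  proof -
    have "(c / c') powr (\<Sum>i\<in>S. - real (\<kappa> i)) = inverse ((c / c') powr real K)"
      by (simp add: K_def sum_negf powr_minus)
    also have "\<dots> = r ^ K" using c by (simp add: r_def powr_realpow power_divide)
    finally show ?thesis by simp
  qed
  also have "(\<lambda>i. if i \<in> S then 1 / c' else 1 / x i) = (\<lambda>i. 1 / (if i \<in> S then c' else x i))" by auto
  finally show ?thesis by (simp add: mult_ac)
qed

text \<open>The values below \<open>1\<close> are moved to \<open>1\<close> first, then those above. Here \<open>l1\<close> and \<open>l2\<close> count the blocks below and
  above \<open>1\<close>; at \<open>x = 1\<close> the block polynomial is the total mass \<open>1\<close>.\<close>
lemma capacity_bound: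
  assumes x: "\<And>i. 0 < x i"
  shows "\<exists>l1 l2. l1 + l2 \<le> card J \<and>
    (\<Prod>k\<in>{1..l1}. \<phi> k) * (\<Prod>k\<in>{1..l2}. \<psi> k) * (\<Prod>i\<in>J. x i ^ \<kappa> i) \<le> block_poly J x"
proof -
  define W where "W = {i\<in>J. x i < 1}"
  define V where "V = {i\<in>J. x i > 1}"
  define y where "y = (\<lambda>i. if i \<in> J \<and> x i < 1 then 1 else x i)"
  have y: "y i > 0" for i using x by (simp add: y_def)
  have fin_WV: "finite W" "finite V" "W \<inter> V = {}" "W \<union> V \<subseteq> J" using finJ by (auto simp: W_def V_def)
  have down: "(\<Prod>k\<in>{1..card W}. \<phi> k) * (\<Prod>i\<in>W. x i powr real (\<kappa> i)) * block_poly J y \<le> block_poly J x"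
    unfolding W_def y_def by (rule chain_peel[OF finJ \<phi>(2) block_peel_down x])
  have "(\<Prod>k\<in>{1..card {i\<in>J. 1 / y i < 1}}. \<psi> k) * (\<Prod>i\<in>{i\<in>J. 1 / y i < 1}. (1 / y i) powr (- real (\<kappa> i)))
    * block_poly J (\<lambda>i. 1 / (if i \<in> J \<and> 1 / y i < 1 then 1 else 1 / y i)) \<le> block_poly J (\<lambda>i. 1 / (1 / y i))"
    by (rule chain_peel[OF finJ \<psi>(2) block_peel_up]) (use y in auto)
  moreover have "{i\<in>J. 1 / y i < 1} = V" using x by (auto simp: V_def y_def)
  moreover have "block_poly J (\<lambda>i. 1 / (if i \<in> J \<and> 1 / y i < 1 then 1 else 1 / y i)) = block_poly J (\<lambda>_. 1)"
    by (rule block_poly_cong) (use x in \<open>auto simp: y_def not_less\<close>)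
  moreover have "block_poly J (\<lambda>_. 1) = 1" using total by (simp add: block_poly_def weight_poly_def)
  moreover have "(\<Prod>i\<in>V. (1 / y i) powr (- real (\<kappa> i))) = (\<Prod>i\<in>V. x i ^ \<kappa> i)"
    using x by (intro prod.cong refl) (auto simp: V_def y_def powr_minus powr_divide powr_realpow)
  ultimately have up: "(\<Prod>k\<in>{1..card V}. \<psi> k) * (\<Prod>i\<in>V. x i ^ \<kappa> i) \<le> block_poly J y" by simp
  have "(\<Prod>i\<in>J. x i ^ \<kappa> i) = (\<Prod>i\<in>W \<union> V. x i ^ \<kappa> i)"
    using fin_WV finJ by (intro prod.mono_neutral_right) (force simp: W_def V_def)+
  also have "\<dots> = (\<Prod>i\<in>W. x i ^ \<kappa> i) * (\<Prod>i\<in>V. x i ^ \<kappa> i)"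
    using fin_WV by (intro prod.union_disjoint) auto
  finally have "(\<Prod>k\<in>{1..card W}. \<phi> k) * (\<Prod>k\<in>{1..card V}. \<psi> k) * (\<Prod>i\<in>J. x i ^ \<kappa> i)
    = (\<Prod>k\<in>{1..card W}. \<phi> k) * (\<Prod>i\<in>W. x i ^ \<kappa> i) * ((\<Prod>k\<in>{1..card V}. \<psi> k) * (\<Prod>i\<in>V. x i ^ \<kappa> i))"
    by (simp add: mult_ac)
  also have "\<dots> \<le> (\<Prod>k\<in>{1..card W}. \<phi> k) * (\<Prod>i\<in>W. x i ^ \<kappa> i) * block_poly J y"
    using \<phi>(2) x by (intro mult_left_mono up mult_nonneg_nonneg prod_nonneg) (auto simp: less_imp_le)
  also have "\<dots> \<le> block_poly J x" using down x by (simp add: powr_realpow)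
  finally have "(\<Prod>k\<in>{1..card W}. \<phi> k) * (\<Prod>k\<in>{1..card V}. \<psi> k) * (\<Prod>i\<in>J. x i ^ \<kappa> i) \<le> block_poly J x" .
  moreover have "card W + card V \<le> card J"
    using fin_WV finJ by (metis card_Un_disjoint card_mono)
  ultimately show ?thesis by blast
qed

end

section \<open>Removing the truncation at one\<close>

lemma prod_subset_le:
  fixes f :: "nat \<Rightarrow> real"
  assumes "finite B" "A \<subseteq> B" "\<And>k. k \<in> B \<Longrightarrow> 0 \<le> f k \<and> f k \<le> 1"
  shows "prod f B \<le> prod f A"
proof -
  have "prod f B = prod f (B - A) * prod f A" using assms by (intro prod.subset_diff) auto
  also have "\<dots> \<le> 1 * prod f A"
    using assms by (intro mult_right_mono prod_le_1 prod_nonneg) auto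
  finally show ?thesis by simp
qed

text \<open>Drop trailing factors \<open>E k > 1\<close>, whose truncation is \<open>1\<close>, until all the remaining ones are at most \<open>1\<close>; by
  assumption \<open>up\<close> they form an initial segment. The dropped factors make room for further factors
  \<open>F k\<close>, which are at most \<open>1\<close>.\<close>
lemma truncated_product_bound:
  fixes E F :: "nat \<Rightarrow> real"
  assumes pos: "\<And>k. k \<in> {1..n} \<Longrightarrow> 0 < E k \<and> 0 < F k"
    and F1: "\<And>k. k \<in> {1..n} \<Longrightarrow> F k \<le> 1"
    and up: "\<And>j k. 1 \<le> j \<Longrightarrow> j \<le> k \<Longrightarrow> k \<le> n \<Longrightarrow> E j > 1 \<Longrightarrow> E k > 1"
    and "l1 + l2 \<le> n"
  shows "\<exists>l\<le>n. (\<Prod>k\<in>{1..l}. E k) * (\<Prod>k\<in>{1..n-l}. F k)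
      \<le> (\<Prod>k\<in>{1..l1}. min 1 (E k)) * (\<Prod>k\<in>{1..l2}. min 1 (F k))"
  using \<open>l1 + l2 \<le> n\<close>
proof (induction l1)
  case 0
  have "(\<Prod>k\<in>{1..n}. F k) \<le> (\<Prod>k\<in>{1..l2}. F k)"
    using 0 pos F1 by (intro prod_subset_le) (auto intro: less_imp_le)
  also have "\<dots> = (\<Prod>k\<in>{1..l2}. min 1 (F k))"
    using 0 F1 by (intro prod.cong) auto
  finally show ?case by (intro exI[of _ 0]) simp
next
  case (Suc l1)
  show ?case
  proof (cases "E (Suc l1) > 1")
    case True
    then show ?thesis using Suc by simp
  next
    case False
    have "E k \<le> 1" if "k \<in> {1..Suc l1}" for k
      using up[of k "Suc l1"] that False Suc.prems by force
    then have "(\<Prod>k\<in>{1..Suc l1}. min 1 (E k)) = (\<Prod>k\<in>{1..Suc l1}. E k)"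
      by (intro prod.cong) auto
    moreover have "(\<Prod>k\<in>{1..n - Suc l1}. F k) \<le> (\<Prod>k\<in>{1..l2}. F k)"
      using Suc.prems pos F1 by (intro prod_subset_le) (auto intro: less_imp_le)
    moreover have "(\<Prod>k\<in>{1..l2}. min 1 (F k)) = (\<Prod>k\<in>{1..l2}. F k)"
      using Suc.prems F1 by (intro prod.cong) auto
    moreover have "0 \<le> (\<Prod>k\<in>{1..Suc l1}. E k)"
      using Suc.prems pos by (intro prod_nonneg) (auto intro: less_imp_le)
    ultimately show ?thesis using Suc.prems
      by (intro exI[of _ "Suc l1"]) (simp del: prod.cl_ivl_Suc add: mult_left_mono)
  qed
qed

lemma sum_remove_each:
  fixes d :: "nat \<Rightarrow> real"
  assumes "finite S"
  shows "(\<Sum>i\<in>S. sum d (S - {i})) = (real (card S) - 1) * sum d S"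
proof -
  have "(\<Sum>i\<in>S. sum d (S - {i})) = (\<Sum>i\<in>S. sum d S - d i)"
    using assms by (intro sum.cong refl) (simp add: sum_diff1)
  then show ?thesis by (simp add: sum_subtractf algebra_simps)
qed

text \<open>A sum over a set is, up to a positive factor, the sum of those over its subsets with one element
  removed.\<close>
lemma all_sums_neg_up:
  fixes d :: "nat \<Rightarrow> real"
  assumes "finite I" "1 \<le> j" "j \<le> k" and neg: "\<And>S. S \<subseteq> I \<Longrightarrow> card S = j \<Longrightarrow> sum d S < 0"
  shows "\<forall>S\<subseteq>I. card S = k \<longrightarrow> sum d S < 0"
  using \<open>j \<le> k\<close>
proof (induction k rule: dec_induct)
  case (step k)
  show ?case
  proof (intro allI impI)
    fix S assume S: "S \<subseteq> I" "card S = Suc k"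
    then have fS: "finite S" "S \<noteq> {}" using assms(1) finite_subset by auto
    have "sum d (S - {i}) < 0" if "i \<in> S" for i
    proof -
      have "S - {i} \<subseteq> I" "card (S - {i}) = k" using that S fS by auto
      then show ?thesis using step.IH by blast
    qed
    then have "(\<Sum>i\<in>S. sum d (S - {i})) < 0"
      using fS sum_strict_mono[of S "\<lambda>i. sum d (S - {i})" "\<lambda>_. 0"] by auto
    then have "real k * sum d S < 0" using sum_remove_each[OF fS(1), of d] S by simp
    then show "sum d S < 0" by (simp add: mult_less_0_iff)
  qed
qed (use neg in auto)

text \<open>The averaging of \<open>all_sums_neg_up\<close> read downwards.\<close>
lemma some_sum_neg_down:
  fixes d :: "nat \<Rightarrow> real"
  assumes "finite I" "1 \<le> k" "k \<le> card I" and neg: "sum d I < 0"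
  shows "\<exists>S\<subseteq>I. card S = k \<and> sum d S < 0"
  using \<open>k \<le> card I\<close> \<open>1 \<le> k\<close>
proof (induction k rule: inc_induct)
  case (step k)
  obtain S where S: "S \<subseteq> I" "card S = Suc k" "sum d S < 0"
    using step.IH by auto
  then have fS: "finite S" using assms(1) finite_subset by auto
  have "(\<Sum>i\<in>S. sum d (S - {i})) = real k * sum d S" using sum_remove_each[OF fS, of d] S by simp
  also have "\<dots> < 0" using S step.prems by (simp add: mult_less_0_iff)
  finally obtain i where "i \<in> S" "sum d (S - {i}) < 0"
    by (meson linorder_not_le sum_nonneg)
  then show ?case using S fS by (intro exI[of _ "S - {i}"]) auto
qed (use neg in auto)

text \<open>By averaging, \<open>E k > 1\<close> for some \<open>k\<close> forces all \<open>F k\<close> below \<open>1\<close>, and the same with \<open>E\<close> and \<open>F\<close> exchanged. So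
  \<open>truncated_product_bound\<close> applies to \<open>E\<close>, \<open>F\<close> or, after exchanging their roles, to \<open>F\<close>, \<open>E\<close>.\<close>
lemma truncated_products_ge_Min:
  fixes d :: "nat \<Rightarrow> real" and n :: nat
  defines "fam \<equiv> \<lambda>k. {S. S \<subseteq> {1..n} \<and> card S = k}"
  defines "E \<equiv> \<lambda>k. 1 - (MAX S\<in>fam k. sum d S)" and "F \<equiv> \<lambda>k. 1 + (MIN S\<in>fam k. sum d S)"
  assumes small: "\<And>S. S \<subseteq> {1..n} \<Longrightarrow> \<bar>sum d S\<bar> < 1" and l: "l1 + l2 \<le> n"
  shows "(MIN l\<in>{0..n}. (\<Prod>k\<in>{1..l}. E k) * (\<Prod>k\<in>{1..n-l}. F k))
      \<le> (\<Prod>k\<in>{1..l1}. min 1 (E k)) * (\<Prod>k\<in>{1..l2}. min 1 (F k))"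
proof -
  have fin: "finite (fam k)" for k
    unfolding fam_def by (rule finite_subset[of _ "Pow {1..n}"]) auto
  have ne: "fam k \<noteq> {}" if "k \<in> {1..n}" for k
    using that obtain_subset_with_card_n[of k "{1..n}"] unfolding fam_def by auto
  have E_gt: "E k > 1 \<longleftrightarrow> (\<forall>S\<in>fam k. sum d S < 0)" if "k \<in> {1..n}" for k
    using fin ne[OF that] by (simp add: E_def)
  have F_gt: "F k > 1 \<longleftrightarrow> (\<forall>S\<in>fam k. sum d S > 0)" if "k \<in> {1..n}" for k
    using fin ne[OF that] by (simp add: F_def)
  have E_le: "E k \<le> 1 \<longleftrightarrow> (\<exists>S\<in>fam k. sum d S \<ge> 0)" if "k \<in> {1..n}" for k
    using E_gt[OF that] by (meson linorder_not_le)
  have pos: "0 < E k \<and> 0 < F k" if "k \<in> {1..n}" for k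
  proof -
    have "\<bar>sum d S\<bar> < 1" if "S \<in> fam k" for S using small that by (auto simp: fam_def)
    then have "(MAX S\<in>fam k. sum d S) < 1" "(MIN S\<in>fam k. sum d S) > -1"
      using fin ne[OF that] by (auto simp: abs_less_iff)
    then show ?thesis by (simp add: E_def F_def)
  qed
  have E_up: "E k > 1" if "1 \<le> j" "j \<le> k" "k \<le> n" "E j > 1" for j k
  proof -
    have "\<forall>S\<subseteq>{1..n}. card S = k \<longrightarrow> sum d S < 0"
    proof (rule all_sums_neg_up[OF _ that(1,2)])
      show "sum d S < 0" if "S \<subseteq> {1..n}" "card S = j" for S
        using E_gt[of j] \<open>E j > 1\<close> \<open>1 \<le> j\<close> \<open>j \<le> k\<close> \<open>k \<le> n\<close> that by (simp add: fam_def)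
    qed simp
    then show ?thesis using E_gt[of k] that by (simp add: fam_def)
  qed
  have F_up: "F k > 1" if "1 \<le> j" "j \<le> k" "k \<le> n" "F j > 1" for j k
  proof -
    have "\<forall>S\<subseteq>{1..n}. card S = k \<longrightarrow> sum (\<lambda>i. - d i) S < 0"
    proof (rule all_sums_neg_up[OF _ that(1,2)])
      show "sum (\<lambda>i. - d i) S < 0" if "S \<subseteq> {1..n}" "card S = j" for S
        using F_gt[of j] \<open>F j > 1\<close> \<open>1 \<le> j\<close> \<open>j \<le> k\<close> \<open>k \<le> n\<close> that by (simp add: fam_def sum_negf)
    qed simp
    then show ?thesis using F_gt[of k] that by (simp add: fam_def sum_negf)
  qed
  have "\<exists>l\<le>n. (\<Prod>k\<in>{1..l}. E k) * (\<Prod>k\<in>{1..n-l}. F k)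
      \<le> (\<Prod>k\<in>{1..l1}. min 1 (E k)) * (\<Prod>k\<in>{1..l2}. min 1 (F k))"
  proof (cases "\<forall>k\<in>{1..n}. F k \<le> 1")
    case True
    then show ?thesis using pos E_up l by (intro truncated_product_bound) auto
  next
    case False
    then obtain j where j: "j \<in> {1..n}" "F j > 1" by force
    then have "F n > 1" "n \<in> {1..n}" using F_up[of j n] by auto
    then have "sum d {1..n} > 0" using F_gt[of n] by (auto simp: fam_def)
    then have "sum (\<lambda>i. - d i) {1..n} < 0" by (simp add: sum_negf)
    have "E k \<le> 1" if "k \<in> {1..n}" for k
    proof -
      have "\<exists>S\<subseteq>{1..n}. card S = k \<and> sum (\<lambda>i. - d i) S < 0"
        using that by (intro some_sum_neg_down[OF _ _ _ \<open>sum (\<lambda>i. - d i) {1..n} < 0\<close>]) auto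
      then obtain S where "S \<subseteq> {1..n}" "card S = k" "sum (\<lambda>i. - d i) S < 0" by blast
      then have "S \<in> fam k" "sum d S \<ge> 0" by (simp_all add: fam_def sum_negf)
      then show ?thesis using E_le[OF that] by blast
    qed
    then have "\<exists>l\<le>n. (\<Prod>k\<in>{1..l}. F k) * (\<Prod>k\<in>{1..n-l}. E k)
      \<le> (\<Prod>k\<in>{1..l2}. min 1 (F k)) * (\<Prod>k\<in>{1..l1}. min 1 (E k))"
      using pos F_up l by (intro truncated_product_bound) auto
    then obtain l where "l \<le> n" "(\<Prod>k\<in>{1..l}. F k) * (\<Prod>k\<in>{1..n-l}. E k)
      \<le> (\<Prod>k\<in>{1..l2}. min 1 (F k)) * (\<Prod>k\<in>{1..l1}. min 1 (E k))" by blast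
    then show ?thesis by (intro exI[of _ "n - l"]) (simp add: mult.commute)
  qed
  then obtain l where "l \<le> n" "(\<Prod>k\<in>{1..l}. E k) * (\<Prod>k\<in>{1..n-l}. F k)
      \<le> (\<Prod>k\<in>{1..l1}. min 1 (E k)) * (\<Prod>k\<in>{1..l2}. min 1 (F k))" by blast
  then show ?thesis by (intro order_trans[OF Min_le]) auto
qed

section \<open>The point probability\<close>

lemma deviation_eq_sum:
  assumes supp: "set_pmf \<mu> \<subseteq> Pow {1..m}"
  shows "deviation \<mu> D \<kappa> S = (\<Sum>i\<in>S. (\<Sum>T\<in>Pow {1..m}. pmf \<mu> T * real (count_in D i T)) - real (\<kappa> i))"
proof -
  have "measure_pmf.expectation \<mu> f = (\<Sum>T\<in>Pow {1..m}. pmf \<mu> T * f T)" for f :: "nat set \<Rightarrow> real"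
    using supp by (subst integral_measure_pmf_real[of "Pow {1..m}"]) (auto simp: mult.commute)
  then have "deviation \<mu> D \<kappa> S = (\<Sum>T\<in>Pow {1..m}. pmf \<mu> T * (\<Sum>i\<in>S. real (count_in D i T))) - (\<Sum>i\<in>S. real (\<kappa> i))"
    by (simp add: deviation_def)
  also have "(\<Sum>T\<in>Pow {1..m}. pmf \<mu> T * (\<Sum>i\<in>S. real (count_in D i T)))
      = (\<Sum>i\<in>S. \<Sum>T\<in>Pow {1..m}. pmf \<mu> T * real (count_in D i T))"
    unfolding sum_distrib_left by (rule sum.swap)
  finally show ?thesis by (simp add: sum_subtractf)
qed

theorem theorem4p1:
  fixes m n :: nat and \<mu> :: "nat set pmf"
    and D :: "nat \<Rightarrow> nat set" and \<kappa> :: "nat \<Rightarrow> nat"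
  assumes "strongly_Rayleigh m \<mu>"
    and "\<And>i. i \<in> {1..n} \<Longrightarrow> D i \<subseteq> {1..m}"
    and "disjoint_family_on D {1..n}"
    and "\<And>S. S \<subseteq> {1..n} \<Longrightarrow> \<bar>deviation \<mu> D \<kappa> S\<bar> < 1"
  shows "measure_pmf.prob \<mu> {T. \<forall>i\<in>{1..n}. count_in D i T = \<kappa> i}
    \<ge> (\<Prod>i\<in>{1..n}. real (\<kappa> i) ^ \<kappa> i * exp (- real (\<kappa> i)) / fact (\<kappa> i))
      * (MIN l\<in>{0..n}. (\<Prod>k\<in>{1..l}. epsilon n \<mu> D \<kappa> k) * (\<Prod>k\<in>{1..n-l}. delta n \<mu> D \<kappa> k))"
proof -
  have supp: "set_pmf \<mu> \<subseteq> Pow {1..m}"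
    using assms(1) by (simp add: strongly_Rayleigh_def)
  define U where "U = {1..m}"
  \<comment> \<open>block \<open>0\<close> collects the elements outside all the sets \<open>D i\<close>\<close>
  define blk where "blk = (\<lambda>e. if \<exists>i\<in>{1..n}. e \<in> D i then SOME i. i \<in> {1..n} \<and> e \<in> D i else 0)"
  have blk_iff: "blk e = i \<longleftrightarrow> e \<in> D i" if i: "i \<in> {1..n}" for e i
  proof (cases "\<exists>j\<in>{1..n}. e \<in> D j")
    case True
    then have "blk e \<in> {1..n} \<and> e \<in> D (blk e)"
      unfolding blk_def by (simp del: atLeastAtMost_iff) (rule someI_ex, blast)
    then show ?thesis using assms(3) i unfolding disjoint_family_on_def by blast
  next
    case False
    then show ?thesis using i by (auto simp: blk_def)
  qed
  have blk_range: "blk e \<in> {0..n}" for e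
  proof (cases "\<exists>j\<in>{1..n}. e \<in> D j")
    case True
    then obtain j where "j \<in> {1..n}" "blk e = j" using blk_iff by blast
    then show ?thesis by simp
  qed (simp add: blk_def)
  define dv where "dv = (\<lambda>i. (\<Sum>T\<in>Pow U. pmf \<mu> T * real (count_in D i T)) - real (\<kappa> i))"
  have dev: "deviation \<mu> D \<kappa> S = sum dv S" for S
    unfolding dv_def U_def by (rule deviation_eq_sum[OF supp])
  define E F where "E = epsilon n \<mu> D \<kappa>" and "F = delta n \<mu> D \<kappa>"
  define fam where "fam = (\<lambda>k. {S. S \<subseteq> {1..n} \<and> card S = k})"
  have E: "E k = 1 - (MAX S\<in>fam k. sum dv S)" and F: "F k = 1 + (MIN S\<in>fam k. sum dv S)" for k
    unfolding E_def F_def epsilon_def delta_def fam_def dev by simp_all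
  have fin_fam: "finite (fam k)" for k
    unfolding fam_def by (rule finite_subset[of _ "Pow {1..n}"]) auto
  have E_le: "E (card S) \<le> 1 - sum dv S" and F_le: "F (card S) \<le> 1 + sum dv S" if "S \<subseteq> {1..n}" for S
  proof -
    have "sum dv S \<in> sum dv ` fam (card S)" using that by (auto simp: fam_def)
    then show "E (card S) \<le> 1 - sum dv S" "F (card S) \<le> 1 + sum dv S"
      unfolding E F using fin_fam by (simp_all add: Max_ge Min_le)
  qed
  have EF_pos: "E k > 0 \<and> F k > 0" if k: "k \<in> {1..n}" for k
  proof -
    have "fam k \<noteq> {}" using k obtain_subset_with_card_n[of k "{1..n}"] unfolding fam_def by auto
    then have "(MAX S\<in>fam k. sum dv S) \<in> sum dv ` fam k" "(MIN S\<in>fam k. sum dv S) \<in> sum dv ` fam k"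
      using fin_fam by (simp_all add: Max_in Min_in)
    moreover have "\<bar>a\<bar> < 1" if "a \<in> sum dv ` fam k" for a
      using that assms(4) by (auto simp: fam_def dev)
    ultimately have "\<bar>MAX S\<in>fam k. sum dv S\<bar> < 1" "\<bar>MIN S\<in>fam k. sum dv S\<bar> < 1" by blast+
    then show ?thesis unfolding E F by linarith
  qed
  define \<phi> where "\<phi> = (\<lambda>k. max 0 (min 1 (E k)))"
  define \<psi> where "\<psi> = (\<lambda>k. max 0 (min 1 (F k)))"
  have st: "half_plane_stable U (pmf \<mu>)"
    using assms(1) unfolding half_plane_stable_def strongly_Rayleigh_def gen_poly_def weight_poly_def U_def by blast
  have block_count: "card {e\<in>T. blk e = i} = count_in D i T" if "i \<in> {1..n}" for T i
    unfolding count_in_def by (rule arg_cong[of _ _ card]) (use blk_iff[OF that] in auto)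
  interpret block_weight U "pmf \<mu>" "{0..n}" blk
  proof
    show "finite U" by (simp add: U_def)
  qed (simp_all only: pmf_nonneg st blk_range finite_atLeastAtMost)
  have cnt': "block_count T i = count_in D i T" if "i \<in> {1..n}" for T i
    unfolding block_count_def by (rule block_count[OF that])
  interpret block_prob U "pmf \<mu>" "{0..n}" blk "{1..n}" \<kappa> dv \<phi> \<psi>
  proof
    show "(\<Sum>T\<in>Pow U. pmf \<mu> T) = 1" using supp by (intro sum_pmf_eq_1) (auto simp: U_def)
    show "dv i = (\<Sum>T\<in>Pow U. pmf \<mu> T * real (block_count T i)) - real (\<kappa> i)" if "i \<in> {1..n}" for i
      using cnt'[OF that] by (simp add: dv_def)
    show "\<bar>sum dv S\<bar> < 1" if "S \<subseteq> {1..n}" for S using assms(4)[OF that] by (simp add: dev)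
    show "\<phi> (card S) \<le> max 0 (min 1 (1 - sum dv S))" if "S \<subseteq> {1..n}" for S
      unfolding \<phi>_def using E_le[OF that] by (intro max.mono min.mono) auto
    show "\<psi> (card S) \<le> max 0 (min 1 (1 + sum dv S))" if "S \<subseteq> {1..n}" for S
      unfolding \<psi>_def using F_le[OF that] by (intro max.mono min.mono) auto
  qed (auto simp: \<phi>_def \<psi>_def)
  define M where "M = (MIN l\<in>{0..n}. (\<Prod>k\<in>{1..l}. E k) * (\<Prod>k\<in>{1..n-l}. F k))"
  have M_le: "M \<le> (\<Prod>k\<in>{1..l1}. \<phi> k) * (\<Prod>k\<in>{1..l2}. \<psi> k)" if l: "l1 + l2 \<le> n" for l1 l2
  proof -
    have "M \<le> (\<Prod>k\<in>{1..l1}. min 1 (E k)) * (\<Prod>k\<in>{1..l2}. min 1 (F k))"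
      unfolding M_def E F fam_def
      by (rule truncated_products_ge_Min[OF _ l]) (use assms(4) in \<open>simp add: dev\<close>)
    also have "(\<Prod>k\<in>{1..l1}. min 1 (E k)) = (\<Prod>k\<in>{1..l1}. \<phi> k)"
      using l EF_pos by (intro prod.cong) (auto simp: \<phi>_def less_imp_le)
    also have "(\<Prod>k\<in>{1..l2}. min 1 (F k)) = (\<Prod>k\<in>{1..l2}. \<psi> k)"
      using l EF_pos by (intro prod.cong) (auto simp: \<psi>_def less_imp_le)
    finally show ?thesis .
  qed
  have M_nonneg: "M \<ge> 0"
  proof -
    have "0 \<le> (\<Prod>k\<in>{1..l}. E k) * (\<Prod>k\<in>{1..n-l}. F k)" if "l \<le> n" for l
    proof (intro mult_nonneg_nonneg prod_nonneg)
      show "0 \<le> E k" if "k \<in> {1..l}" for k using EF_pos[of k] that \<open>l \<le> n\<close> by auto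
      show "0 \<le> F k" if "k \<in> {1..n-l}" for k
      proof -
        have "k \<in> {1..n}" using that by auto
        then show ?thesis using EF_pos[of k] by simp
      qed
    qed
    then show ?thesis unfolding M_def by (intro Min.boundedI) auto
  qed
  have "M * (\<Prod>i\<in>{1..n}. real (\<kappa> i) ^ \<kappa> i * exp (- real (\<kappa> i)) / fact (\<kappa> i))
      \<le> (\<Sum>T | T \<subseteq> U \<and> (\<forall>i\<in>{1..n}. block_count T i = \<kappa> i). pmf \<mu> T)"
  proof (rule coefficient_ge_capacity[OF J M_nonneg])
    fix x :: "nat \<Rightarrow> real" assume x: "\<And>i. x i > 0" and x1: "\<And>i. i \<notin> {1..n} \<Longrightarrow> x i = 1"
    have "\<exists>l1 l2. l1 + l2 \<le> card {1..n} \<and>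
      (\<Prod>k\<in>{1..l1}. \<phi> k) * (\<Prod>k\<in>{1..l2}. \<psi> k) * (\<Prod>i\<in>{1..n}. x i ^ \<kappa> i) \<le> block_poly {1..n} x"
      by (rule capacity_bound) (rule x)
    then obtain l1 l2 where l: "l1 + l2 \<le> n"
      and bound: "(\<Prod>k\<in>{1..l1}. \<phi> k) * (\<Prod>k\<in>{1..l2}. \<psi> k) * (\<Prod>i\<in>{1..n}. x i ^ \<kappa> i) \<le> block_poly {1..n} x"
      by auto
    have "M * (\<Prod>i\<in>{1..n}. x i ^ \<kappa> i) \<le> (\<Prod>k\<in>{1..l1}. \<phi> k) * (\<Prod>k\<in>{1..l2}. \<psi> k) * (\<Prod>i\<in>{1..n}. x i ^ \<kappa> i)"
      using x by (intro mult_right_mono M_le[OF l] prod_nonneg) (auto simp: less_imp_le)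
    also note bound
    also have "block_poly {1..n} x = weight_poly U (pmf \<mu>) (\<lambda>e. x (blk e))"
      unfolding block_poly_def by (rule weight_poly_cong) (use x1 in auto)
    finally show "M * (\<Prod>i\<in>{1..n}. x i ^ \<kappa> i) \<le> weight_poly U (pmf \<mu>) (\<lambda>e. x (blk e))" .
  qed
  also have "{T. T \<subseteq> U \<and> (\<forall>i\<in>{1..n}. block_count T i = \<kappa> i)} = {T. T \<subseteq> U \<and> (\<forall>i\<in>{1..n}. count_in D i T = \<kappa> i)}"
    using cnt' by auto
  also have "(\<Sum>T\<in>{T. T \<subseteq> U \<and> (\<forall>i\<in>{1..n}. count_in D i T = \<kappa> i)}. pmf \<mu> T)
      = measure_pmf.prob \<mu> {T. T \<subseteq> U \<and> (\<forall>i\<in>{1..n}. count_in D i T = \<kappa> i)}"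
    by (rule measure_measure_pmf_finite[symmetric]) (auto simp: U_def)
  also have "\<dots> \<le> measure_pmf.prob \<mu> {T. \<forall>i\<in>{1..n}. count_in D i T = \<kappa> i}"
    by (rule measure_pmf.finite_measure_mono) auto
  finally show ?thesis unfolding M_def E_def F_def by (simp add: mult.commute)
qed

end
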